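(* Let $1\le k\le N$ and let $(w_{i,j})_{i,j\ge 1}$ be i.i.d. exponential random variables with parameter one. For $M\ge N$ set $$H_k(M,N)=\max\Big\{\sum_{(i,j)\in\pi_1\cup\cdots\cup\pi_k}w_{i,j}\ ;\ \pi_1,\ldots,\pi_k\in\mathcal{P}(M,N),\ \pi_1,\ldots,\pi_k\text{ all disjoint}\Big\}.$$ Let $(B_j)_{1\le j\le N}$ be a standard $N$-dimensional Brownian motion. Then, as $M\to\infty$, $$\frac{H_k(M,N)-kM}{\sqrt{M}}\ \longrightarrow\ \Omega_k^{(N)}:=\sup\ \sum_{j=1}^N\sum_{p=1}^k\big(B_j(s_{j-p+1}^p)-B_j(s_{j-p}^p)\big)\qquad\text{in distribution,}$$ where the supremum is taken over all families $(s_i^p)$, $i\in\mathbb{Z}$, $1\le p\le k$, of elements of $[0,1]$ such that $s_i^{p+1}\le s_i^p$ for all $i$ and $1\le p\le k-1$, $s_i^p\le s_{i+1}^p$ for all $i$ and $1\le p\le k$, $s_i^p=0$ for $i\le 0$, and $s_i^p=1$ for $i\ge N-k+1$.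
   Context: $\mathcal{P}(M,N)$ is the set of all paths $\pi$ taking only unit steps in the north-east direction in the rectangle $\{1,\ldots,M\}\times\{1,\ldots,N\}$, i.e. each step increases exactly one of the two coordinates by $1$; the starting and ending points of a path are arbitrary points of the rectangle. A path is identified with the set of sites it visits, and disjointness means having no site in common. A standard $N$-dimensional Brownian motion consists of $N$ independent standard real Brownian motions started at $0$. *)

theory Defs
  imports "HOL-Probability.Probability"
begin

definition ne_step :: "nat \<times> nat \<Rightarrow> nat \<times> nat \<Rightarrow> bool" where
  "ne_step x y \<longleftrightarrow> y = (fst x + 1, snd x) \<or> y = (fst x, snd x + 1)"

text \<open>A path is identified with the set of sites it visits; it visits at least one site.\<close>

definition ne_paths :: "nat \<Rightarrow> nat \<Rightarrow> (nat \<times> nat) set set" where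
  "ne_paths M N =
    {set xs | xs. xs \<noteq> [] \<and> set xs \<subseteq> {1..M} \<times> {1..N} \<and> successively ne_step xs}"

text \<open>The maximum is over a finite set, which is nonempty as soon as \<open>k \<le> M * N\<close>.\<close>

definition H :: "nat \<Rightarrow> nat \<Rightarrow> nat \<Rightarrow> (nat \<Rightarrow> nat \<Rightarrow> real) \<Rightarrow> real" where
  "H k M N w = Max {\<Sum>(i, j)\<in>(\<Union>p\<in>{1..k}. \<pi> p). w i j | \<pi>.
     (\<forall>p\<in>{1..k}. \<pi> p \<in> ne_paths M N) \<and> disjoint_family_on \<pi> {1..k}}"

text \<open>All sample paths, rather than almost all of them, start at 0 and are continuous.\<close>

definition standard_BM :: "'a measure \<Rightarrow> (real \<Rightarrow> 'a \<Rightarrow> real) \<Rightarrow> bool" where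
  "standard_BM Q B \<longleftrightarrow>
     prob_space Q \<and>
     (\<forall>t\<ge>0. B t \<in> borel_measurable Q) \<and>
     (\<forall>\<omega>\<in>space Q. B 0 \<omega> = 0) \<and>
     (\<forall>\<omega>\<in>space Q. continuous_on {0..} (\<lambda>t. B t \<omega>)) \<and>
     (\<forall>s t. 0 \<le> s \<longrightarrow> s < t \<longrightarrow>
        distributed Q lborel (\<lambda>\<omega>. B t \<omega> - B s \<omega>) (normal_density 0 (sqrt (t - s)))) \<and>
     (\<forall>(t :: nat \<Rightarrow> real) n. 0 \<le> t 0 \<longrightarrow> (\<forall>i<n. t i \<le> t (Suc i)) \<longrightarrow>
        prob_space.indep_vars Q (\<lambda>_. borel) (\<lambda>i \<omega>. B (t (Suc i)) \<omega> - B (t i) \<omega>) {..<n})"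

text \<open>The components are independent as whole processes, that is, as random elements of the
  product space of real functions on \<open>{0..}\<close>.\<close>

definition standard_BM_dim :: "'a measure \<Rightarrow> nat \<Rightarrow> (nat \<Rightarrow> real \<Rightarrow> 'a \<Rightarrow> real) \<Rightarrow> bool" where
  "standard_BM_dim Q N B \<longleftrightarrow>
     prob_space Q \<and>
     (\<forall>j\<in>{1..N}. standard_BM Q (B j)) \<and>
     prob_space.indep_vars Q (\<lambda>_. \<Pi>\<^sub>M t\<in>{0..}. borel) (\<lambda>j \<omega>. \<lambda>t\<in>{0..}. B j t \<omega>) {1..N}"

text \<open>\<open>s p i\<close> stands for $s_i^p$; the values for \<open>p \<notin> {1..k}\<close> are irrelevant.\<close>

definition interlacing :: "nat \<Rightarrow> nat \<Rightarrow> (nat \<Rightarrow> int \<Rightarrow> real) set" where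
  "interlacing k N = {s.
     (\<forall>p\<in>{1..k}. \<forall>i. s p i \<in> {0..1}) \<and>
     (\<forall>p. 1 \<le> p \<and> p + 1 \<le> k \<longrightarrow> (\<forall>i. s (p + 1) i \<le> s p i)) \<and>
     (\<forall>p\<in>{1..k}. \<forall>i. s p i \<le> s p (i + 1)) \<and>
     (\<forall>p\<in>{1..k}. \<forall>i\<le>0. s p i = 0) \<and>
     (\<forall>p\<in>{1..k}. \<forall>i\<ge>int N - int k + 1. s p i = 1)}"

text \<open>For \<open>1 \<le> k \<le> N\<close> and \<open>b j\<close> continuous on \<open>{0..1}\<close>, this is the supremum of a
  nonempty bounded set of reals.\<close>

definition Omega :: "nat \<Rightarrow> nat \<Rightarrow> (nat \<Rightarrow> real \<Rightarrow> real) \<Rightarrow> real" where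
  "Omega k N b = (SUP s\<in>interlacing k N. \<Sum>j=1..N. \<Sum>p=1..k.
     b j (s p (int j - int p + 1)) - b j (s p (int j - int p)))"

end

theory Submission
  imports Defs
begin

text \<open>
  In a strip of fixed height \<open>N\<close> an up-right path moves vertically in at most \<open>N\<close> columns. In all other
  columns \<open>k\<close> disjoint paths occupy at most one row each, and the sets of occupied rows can be enlarged
  to sets with exactly \<open>k\<close> elements that move upwards, element by element, as the column index
  increases (\<open>sum_le_path_gain\<close>). The times at which the \<open>p\<close>-th smallest row jumps form an
  interlacing array; conversely, an interlacing array gives \<open>k\<close> disjoint paths once its entries are
  slightly separated (\<open>path_gain_le_disjoint_paths\<close>). Every path of an array crosses the whole strip,
  so centring the weights subtracts exactly \<open>k * M\<close>. Hence the centred and rescaled maximum is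
  \<open>Omega\<close> applied to the rescaled centred row walks, up to a constant times the largest weight divided
  by \<open>sqrt M\<close> (\<open>H_approx\<close>), and for exponential weights this error vanishes in probability.

  It remains to pass to the limit in the row walks. \<open>Omega\<close> is Lipschitz in the supremum norm
  (\<open>Omega_diff_le\<close>), so the walks may be sampled on a grid of mesh \<open>1 / L\<close>. The sampled functional is
  a continuous function of finitely many independent block sums. Each of these satisfies the central
  limit theorem, and Skorohod's representation, applied to each coordinate and combined on a product
  space, gives joint convergence (\<open>indep_weak_conv_integral\<close>). The sampling error is controlled
  uniformly in \<open>M\<close> by Ottaviani's maximal inequality and fourth moments for the walks
  (\<open>oscillation_event\<close>), and by uniform continuity for the Brownian paths (\<open>Omega_grid_approx\<close>).
  Comparing characteristic functions and letting first \<open>M\<close> and then \<open>L\<close> tend to infinity proves the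
  theorem.
\<close>

section \<open>The gain of an interlacing array\<close>

definition path_gain :: "nat \<Rightarrow> nat \<Rightarrow> (nat \<Rightarrow> real \<Rightarrow> real) \<Rightarrow> (nat \<Rightarrow> int \<Rightarrow> real) \<Rightarrow> real" where
  "path_gain k N b s = (\<Sum>j=1..N. \<Sum>p=1..k.
     b j (s p (int j - int p + 1)) - b j (s p (int j - int p)))"

lemma Omega_eq: "Omega k N b = (SUP s\<in>interlacing k N. path_gain k N b s)"
  by (simp add: Omega_def path_gain_def)

lemma interlacing_nonempty:
  assumes "k \<le> N"
  shows "interlacing k N \<noteq> {}"
proof -
  have "(\<lambda>p i. if i \<le> 0 then 0 else 1) \<in> interlacing k N"
    using assms by (auto simp: interlacing_def)
  then show ?thesis by blast
qed

lemma interlacing_range: "s \<in> interlacing k N \<Longrightarrow> p \<in> {1..k} \<Longrightarrow> s p i \<in> {0..1}"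
  by (auto simp: interlacing_def)

lemma path_gain_abs_le:
  assumes s: "s \<in> interlacing k N" and b: "\<And>j t. j \<in> {1..N} \<Longrightarrow> t \<in> {0..1} \<Longrightarrow> \<bar>b j t\<bar> \<le> K"
  shows "\<bar>path_gain k N b s\<bar> \<le> 2 * real N * real k * K"
proof -
  have "\<bar>path_gain k N b s\<bar> \<le> (\<Sum>j=1..N. \<Sum>p=1..k.
     \<bar>b j (s p (int j - int p + 1)) - b j (s p (int j - int p))\<bar>)"
    unfolding path_gain_def by (intro order_trans[OF sum_abs] sum_mono order_trans[OF sum_abs] order_refl)
  also have "\<dots> \<le> (\<Sum>j=1..N. \<Sum>p=1..k. 2 * K)"
  proof (intro sum_mono)
    fix j p assume jp: "j \<in> {1..N}" "p \<in> {1..k}"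
    show "\<bar>b j (s p (int j - int p + 1)) - b j (s p (int j - int p))\<bar> \<le> 2 * K"
      using b[OF jp(1) interlacing_range[OF s jp(2), of "int j - int p + 1"]]
        b[OF jp(1) interlacing_range[OF s jp(2), of "int j - int p"]] by linarith
  qed
  also have "\<dots> = 2 * real N * real k * K" by simp
  finally show ?thesis .
qed

lemma bdd_path_gain:
  assumes "\<And>j t. j \<in> {1..N} \<Longrightarrow> t \<in> {0..1} \<Longrightarrow> \<bar>b j t\<bar> \<le> K"
  shows "bdd_above (path_gain k N b ` interlacing k N)"
proof (rule bdd_aboveI2)
  fix s assume "s \<in> interlacing k N"
  then show "path_gain k N b s \<le> 2 * real N * real k * K"
    using path_gain_abs_le[of s k N b K] assms by fastforce
qed

lemma path_gain_diff:
  "path_gain k N b s - path_gain k N b' s = path_gain k N (\<lambda>j t. b j t - b' j t) s"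
  unfolding path_gain_def sum_subtractf[symmetric] by (intro sum.cong refl) simp

text \<open>The Lipschitz bound through which every approximation of \<open>Omega\<close> below passes: each of the
  \<open>N * k\<close> increments in a gain evaluates the rows at two points of \<open>{0..1}\<close>.\<close>

lemma Omega_diff_le:
  assumes "k \<le> N"
    and b': "\<And>j t. j \<in> {1..N} \<Longrightarrow> t \<in> {0..1} \<Longrightarrow> \<bar>b' j t\<bar> \<le> K"
    and d: "\<And>j t. j \<in> {1..N} \<Longrightarrow> t \<in> {0..1} \<Longrightarrow> \<bar>b j t - b' j t\<bar> \<le> \<epsilon>"
  shows "Omega k N b \<le> Omega k N b' + 2 * real N * real k * \<epsilon>"
  unfolding Omega_eq
proof (rule cSUP_least[OF interlacing_nonempty[OF \<open>k \<le> N\<close>]])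
  fix s assume s: "s \<in> interlacing k N"
  have "path_gain k N b' s \<le> (SUP s\<in>interlacing k N. path_gain k N b' s)"
    by (rule cSUP_upper[OF s bdd_path_gain[OF b']])
  moreover have "path_gain k N b s - path_gain k N b' s \<le> 2 * real N * real k * \<epsilon>"
    unfolding path_gain_diff
    using path_gain_abs_le[OF s, of "\<lambda>j t. b j t - b' j t" \<epsilon>] d by fastforce
  ultimately show "path_gain k N b s \<le> (SUP s\<in>interlacing k N. path_gain k N b' s) + 2 * real N * real k * \<epsilon>"
    by linarith
qed

lemma Omega_abs_diff_le:
  assumes "k \<le> N"
    and b: "\<And>j t. j \<in> {1..N} \<Longrightarrow> t \<in> {0..1} \<Longrightarrow> \<bar>b j t\<bar> \<le> K"
    and b': "\<And>j t. j \<in> {1..N} \<Longrightarrow> t \<in> {0..1} \<Longrightarrow> \<bar>b' j t\<bar> \<le> K'"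
    and d: "\<And>j t. j \<in> {1..N} \<Longrightarrow> t \<in> {0..1} \<Longrightarrow> \<bar>b j t - b' j t\<bar> \<le> \<epsilon>"
  shows "\<bar>Omega k N b - Omega k N b'\<bar> \<le> 2 * real N * real k * \<epsilon>"
proof -
  have d': "\<bar>b' j t - b j t\<bar> \<le> \<epsilon>" if "j \<in> {1..N}" "t \<in> {0..1}" for j t
    using d[OF that] by linarith
  show ?thesis
    using Omega_diff_le[of k N b' K' b \<epsilon>, OF assms(1) b' d] Omega_diff_le[of k N b K b' \<epsilon>, OF assms(1) b d']
    by linarith
qed

lemma Omega_cong:
  assumes "\<And>j t. j \<in> {1..N} \<Longrightarrow> t \<in> {0..1} \<Longrightarrow> b j t = b' j t"
  shows "Omega k N b = Omega k N b'"
  unfolding Omega_eq path_gain_def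
  by (intro SUP_cong refl sum.cong arg_cong2[where f="(-)"] assms interlacing_range) auto

text \<open>Each of the \<open>k\<close> paths crosses the whole time interval, so the gain of a function that does not
  depend on the row telescopes. This is what produces the centring \<open>k * M\<close>.\<close>

lemma path_gain_row_independent:
  assumes "k \<le> N" and s: "s \<in> interlacing k N"
  shows "path_gain k N (\<lambda>j. g) s = real k * (g 1 - g 0)"
proof -
  have "path_gain k N (\<lambda>j. g) s = (\<Sum>p=1..k. \<Sum>j=1..N. g (s p (int j - int p + 1)) - g (s p (int j - int p)))"
    unfolding path_gain_def by (rule sum.swap)
  also have "\<dots> = (\<Sum>p=1..k. g 1 - g 0)"
  proof (intro sum.cong refl)
    fix p assume p: "p \<in> {1..k}"
    have "(\<Sum>j=1..N. g (s p (int j - int p + 1)) - g (s p (int j - int p)))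
      = (\<Sum>j=1..<Suc N. (\<lambda>j. g (s p (int j - int p))) (Suc j) - (\<lambda>j. g (s p (int j - int p))) j)"
      by (intro sum.cong) (auto simp: algebra_simps)
    also have "\<dots> = g (s p (int (Suc N) - int p)) - g (s p (int 1 - int p))"
      by (subst sum_Suc_diff') auto
    also have "s p (int (Suc N) - int p) = 1"
      using p s \<open>k \<le> N\<close> by (auto simp: interlacing_def)
    also have "s p (int 1 - int p) = 0"
      using p s \<open>k \<le> N\<close> by (auto simp: interlacing_def)
    finally show "(\<Sum>j=1..N. g (s p (int j - int p + 1)) - g (s p (int j - int p))) = g 1 - g 0" .
  qed
  finally show ?thesis by simp
qed

section \<open>Rows occupied by disjoint paths, column by column\<close>

text \<open>Array entries are times in \<open>{0..1}\<close>, so column \<open>i\<close> of \<open>{1..M}\<close> sits at time \<open>i / M\<close> and the row sums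
  become step functions of time.\<close>

definition weight_walk :: "nat \<Rightarrow> (nat \<Rightarrow> nat \<Rightarrow> real) \<Rightarrow> nat \<Rightarrow> real \<Rightarrow> real" where
  "weight_walk M w j t = (\<Sum>i=1..nat \<lfloor>real M * t\<rfloor>. w i j)"

definition rescaled_walk :: "nat \<Rightarrow> (nat \<Rightarrow> nat \<Rightarrow> real) \<Rightarrow> nat \<Rightarrow> real \<Rightarrow> real" where
  "rescaled_walk M w j t = (\<Sum>i=1..nat \<lfloor>real M * t\<rfloor>. w i j - 1) / sqrt (real M)"

lemma path_gain_rescaled_walk:
  assumes "k \<le> N" "s \<in> interlacing k N"
  shows "path_gain k N (rescaled_walk M w) s = (path_gain k N (weight_walk M w) s - real k * real M) / sqrt (real M)"
proof -
  let ?g = "\<lambda>t::real. real (nat \<lfloor>real M * t\<rfloor>)"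
  have "path_gain k N (rescaled_walk M w) s
      = path_gain k N (\<lambda>j t. (weight_walk M w j t - ?g t) / sqrt (real M)) s"
    by (simp add: path_gain_def rescaled_walk_def weight_walk_def sum_subtractf)
  also have "\<dots> = path_gain k N (\<lambda>j t. weight_walk M w j t - ?g t) s / sqrt (real M)"
    by (simp add: path_gain_def sum_divide_distrib diff_divide_distrib)
  also have "path_gain k N (\<lambda>j t. weight_walk M w j t - ?g t) s
      = path_gain k N (weight_walk M w) s - path_gain k N (\<lambda>j. ?g) s"
    by (rule path_gain_diff[symmetric])
  also have "path_gain k N (\<lambda>j. ?g) s = real k * real M"
    by (subst path_gain_row_independent[OF assms]) simp
  finally show ?thesis .
qed

text \<open>In a set of sites without two sites of one path in the same column, a path meets a set of this kind
  in at most one site. Sites of the same column may belong to a chain, so that a chain in rows up to \<open>j\<close>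
  and columns from \<open>i\<close> on can always be extended by a site of row \<open>j + 1\<close> in column \<open>i\<close> itself.\<close>

definition south_east :: "(nat \<times> nat) set \<Rightarrow> bool" where
  "south_east T \<longleftrightarrow> (\<forall>x\<in>T. \<forall>y\<in>T. x = y \<or>
     fst x \<le> fst y \<and> snd y < snd x \<or> fst y \<le> fst x \<and> snd x < snd y)"

text \<open>The counterpart for \<open>south_east\<close> chains of the longest decreasing subsequence of a permutation. The
  sites of a chain lie on different paths, and a path that still has a site in rows up to \<open>j\<close> from
  column \<open>i\<close> on has not risen above row \<open>j\<close> before; so at least this many paths must be kept in these
  rows at column \<open>i\<close>.\<close>

definition se_depth :: "(nat \<times> nat) set \<Rightarrow> nat \<Rightarrow> nat \<Rightarrow> nat" where
  "se_depth A i j = Max {card T | T. T \<subseteq> A \<inter> {i..} \<times> {..j} \<and> south_east T}"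

lemma south_east_subset: "south_east T \<Longrightarrow> T' \<subseteq> T \<Longrightarrow> south_east T'"
  unfolding south_east_def by blast

lemma downward_closed_eq_atLeastAtMost:
  fixes D :: "nat set"
  assumes "D \<subseteq> {1..M}" and down: "\<And>i i'. i \<in> D \<Longrightarrow> 1 \<le> i' \<Longrightarrow> i' \<le> i \<Longrightarrow> i' \<in> D"
  shows "D = {1..card D}"
proof (cases "D = {}")
  case False
  have fin: "finite D" using assms(1) finite_subset by blast
  have "D = {1..Max D}"
  proof (intro equalityI subsetI)
    fix x assume "x \<in> D" then show "x \<in> {1..Max D}" using assms(1) fin by auto
  next
    fix x assume "x \<in> {1..Max D}"
    then show "x \<in> D" using down[OF Max_in[OF fin False]] by auto
  qed
  then show ?thesis by (metis card_atLeastAtMost diff_Suc_1)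
qed simp

context
  fixes k M N :: nat and A :: "(nat \<times> nat) set"
  assumes kN: "k \<le> N" and M: "1 \<le> M" and A: "A \<subseteq> {1..M} \<times> {1..N}"
    and width: "\<And>T. T \<subseteq> A \<Longrightarrow> south_east T \<Longrightarrow> card T \<le> k"
begin

lemma finite_A: "finite A"
  using A finite_subset by blast

lemma finite_depth_set: "finite {card T | T. T \<subseteq> A \<inter> {i..} \<times> {..j} \<and> south_east T}"
proof -
  have "{card T | T. T \<subseteq> A \<inter> {i..} \<times> {..j} \<and> south_east T} \<subseteq> card ` Pow A" by auto
  then show ?thesis using finite_A finite_subset by blast
qed

lemma card_le_depth: "T \<subseteq> A \<inter> {i..} \<times> {..j} \<Longrightarrow> south_east T \<Longrightarrow> card T \<le> se_depth A i j"
  unfolding se_depth_def by (rule Max_ge[OF finite_depth_set]) auto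

lemma depth_attained:
  obtains T where "T \<subseteq> A \<inter> {i..} \<times> {..j}" "south_east T" "card T = se_depth A i j"
proof -
  have "card {} \<in> {card T | T. T \<subseteq> A \<inter> {i..} \<times> {..j} \<and> south_east T}"
    by (auto simp: south_east_def intro!: exI[of _ "{}"])
  then have "se_depth A i j \<in> {card T | T. T \<subseteq> A \<inter> {i..} \<times> {..j} \<and> south_east T}"
    unfolding se_depth_def by (intro Max_in[OF finite_depth_set]) auto
  then show ?thesis using that by auto
qed

lemma depth_le: "se_depth A i j \<le> k"
proof -
  obtain T where "T \<subseteq> A \<inter> {i..} \<times> {..j}" "south_east T" "card T = se_depth A i j"
    by (rule depth_attained)
  then show ?thesis using width[of T] by auto
qed

lemma depth_mono:
  assumes "i' \<le> i" "j \<le> j'"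
  shows "se_depth A i j \<le> se_depth A i' j'"
proof -
  obtain T where T: "T \<subseteq> A \<inter> {i..} \<times> {..j}" "south_east T" "card T = se_depth A i j"
    by (rule depth_attained)
  have "A \<inter> {i..} \<times> {..j} \<subseteq> A \<inter> {i'..} \<times> {..j'}" using assms by auto
  then show ?thesis using card_le_depth[of T i' j'] T by auto
qed

lemma depth_0: "se_depth A i 0 = 0"
proof -
  obtain T where T: "T \<subseteq> A \<inter> {i..} \<times> {..0}" "south_east T" "card T = se_depth A i 0"
    by (rule depth_attained)
  moreover have "A \<inter> {i..} \<times> {..0} = {}" using A by auto
  ultimately have "T = {}" by blast
  then show ?thesis using T(3) by simp
qed

lemma depth_Suc_le: "se_depth A i (Suc j) \<le> Suc (se_depth A i j)"
proof -
  obtain T where T: "T \<subseteq> A \<inter> {i..} \<times> {..Suc j}" "south_east T" "card T = se_depth A i (Suc j)"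
    by (rule depth_attained)
  have fin: "finite T" using T(1) finite_A finite_subset by blast
  let ?R = "{x\<in>T. snd x = Suc j}"
  have "x = y" if "x \<in> ?R" "y \<in> ?R" for x y
    using T(2)[unfolded south_east_def, rule_format, of x y] that by auto
  then have "card ?R \<le> 1"
    by (intro card_le_Suc0_iff_eq[THEN iffD2, of ?R, simplified One_nat_def[symmetric]]) (use fin in auto)
  moreover have "card (T - ?R) \<le> se_depth A i j"
  proof (rule card_le_depth)
    show "T - ?R \<subseteq> A \<inter> {i..} \<times> {..j}" using T(1) by (auto simp: le_Suc_eq)
    show "south_east (T - ?R)" using T(2) by (rule south_east_subset) auto
  qed
  moreover have "card T \<le> card (T - ?R) + card ?R"
    using card_Un_le[of "T - ?R" ?R] by (simp add: Un_absorb2)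
  ultimately show ?thesis using T(3) by linarith
qed

lemma depth_Suc_site:
  assumes "(i, Suc j) \<in> A"
  shows "se_depth A i (Suc j) = Suc (se_depth A i j)"
proof (rule antisym[OF depth_Suc_le])
  obtain T where T: "T \<subseteq> A \<inter> {i..} \<times> {..j}" "south_east T" "card T = se_depth A i j"
    by (rule depth_attained)
  have fin: "finite T" using T(1) finite_A finite_subset by blast
  have "card (insert (i, Suc j) T) \<le> se_depth A i (Suc j)"
  proof (rule card_le_depth)
    show "insert (i, Suc j) T \<subseteq> A \<inter> {i..} \<times> {..Suc j}" using T(1) assms by auto
    show "south_east (insert (i, Suc j) T)"
      using T(1,2) unfolding south_east_def by fastforce
  qed
  moreover have "(i, Suc j) \<notin> T" using T(1) by auto
  ultimately show "Suc (se_depth A i j) \<le> se_depth A i (Suc j)" using T(3) fin by simp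
qed

text \<open>The number of rows up to \<open>j\<close> that the completed configuration occupies in column \<open>i\<close>. A given
  union of paths may leave some columns with fewer than \<open>k\<close> sites; the second argument of the maximum
  fills such columns up with the topmost rows, which makes \<open>level i N = k\<close> while keeping the
  increments in \<open>j\<close> equal to 0 or 1 and the monotonicity in \<open>i\<close>.\<close>

definition level :: "nat \<Rightarrow> nat \<Rightarrow> nat" where
  "level i j = max (se_depth A i j) (k + j - N)"

text \<open>Row \<open>j\<close> belongs to path \<open>p\<close> in column \<open>i\<close> iff \<open>level\<close> passes from \<open>p - 1\<close> to \<open>p\<close> there, that is, iff
  \<open>i\<close> lies between the crossing times with indices \<open>j - p\<close> and \<open>j - p + 1\<close>.\<close>

definition crossing :: "nat \<Rightarrow> int \<Rightarrow> nat" where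
  "crossing p m = card {i\<in>{1..M}. p \<le> level i (nat (m + int p - 1))}"

lemma level_le: "j \<le> N \<Longrightarrow> level i j \<le> k"
  using depth_le[of i j] by (auto simp: level_def)

lemma level_Suc: "level i j \<le> level i (Suc j)" "level i (Suc j) \<le> Suc (level i j)"
  using depth_Suc_le[of i j] depth_mono[of i i j "Suc j"] by (auto simp: level_def)

lemma level_mono: "i' \<le> i \<Longrightarrow> j \<le> j' \<Longrightarrow> level i j \<le> level i' j'"
  using depth_mono[of i' i j j'] by (auto simp: level_def)

lemma level_0: "level i 0 = 0"
  using depth_0[of i] kN by (auto simp: level_def)

lemma level_le_row: "level i j \<le> j"
proof (induction j)
  case (Suc j) then show ?case using level_Suc(2)[of i j] by linarith
qed (simp add: level_0)

lemma level_site: "(i, Suc j) \<in> A \<Longrightarrow> level i (Suc j) = Suc (level i j)"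
  using depth_Suc_site[of i j] by (auto simp: level_def)

lemma crossing_set: "{i\<in>{1..M}. p \<le> level i (nat (m + int p - 1))} = {1..crossing p m}"
  unfolding crossing_def
  by (rule downward_closed_eq_atLeastAtMost[where M=M]) (auto intro: order_trans level_mono)

lemma crossing_le: "crossing p m \<le> M"
proof -
  have "card {i\<in>{1..M}. p \<le> level i (nat (m + int p - 1))} \<le> card {1..M}"
    by (intro card_mono) auto
  then show ?thesis by (simp add: crossing_def)
qed

lemma crossing_interlacing: "(\<lambda>p m. real (crossing p m) / real M) \<in> interlacing k N"
proof -
  have 1: "real (crossing p m) / real M \<in> {0..1}" for p m
    using crossing_le[of p m] M by (auto simp: divide_simps)
  have 2: "crossing (p + 1) m \<le> crossing p m" if "1 \<le> p" for p m
    unfolding crossing_def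
  proof (rule card_mono)
    show "{i \<in> {1..M}. p + 1 \<le> level i (nat (m + int (p + 1) - 1))}
      \<subseteq> {i \<in> {1..M}. p \<le> level i (nat (m + int p - 1))}"
    proof safe
      fix i assume i: "p + 1 \<le> level i (nat (m + int (p + 1) - 1))"
      show "p \<le> level i (nat (m + int p - 1))"
      proof (cases "m + int p \<ge> 1")
        case True
        then have "nat (m + int (p + 1) - 1) = Suc (nat (m + int p - 1))" by auto
        then show ?thesis using i level_Suc(2)[of i "nat (m + int p - 1)"] by auto
      next
        case False then show ?thesis using i by (simp add: level_0)
      qed
    qed
  qed auto
  have 3: "crossing p m \<le> crossing p (m + 1)" for p m
  proof -
    have "level i (nat (m + int p - 1)) \<le> level i (nat (m + 1 + int p - 1))" for i
      by (rule level_mono) auto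
    then show ?thesis
      unfolding crossing_def by (intro card_mono) (auto intro: order_trans)
  qed
  have 4: "crossing p m = 0" if "1 \<le> p" "m \<le> 0" for p m
  proof -
    have "\<not> p \<le> level i (nat (m + int p - 1))" for i
      using level_le_row[of i "nat (m + int p - 1)"] that by auto
    then show ?thesis by (simp add: crossing_def)
  qed
  have 5: "crossing p m = M" if "1 \<le> p" "int N - int k + 1 \<le> m" for p m
  proof -
    have "p \<le> level i (nat (m + int p - 1))" for i
      using that kN by (auto simp: level_def)
    then have "{i\<in>{1..M}. p \<le> level i (nat (m + int p - 1))} = {1..M}" by blast
    then show ?thesis unfolding crossing_def by simp
  qed
  show ?thesis
    unfolding interlacing_def using 1 2 3 4 5 M
    by (auto simp: divide_right_mono)
qed

text \<open>Summing the increments of \<open>level\<close> over \<open>p\<close> shows that the gain is the sum of the weights over all sites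
  at which \<open>level\<close> jumps; every site of \<open>A\<close> is one, and the others contribute nonnegatively.\<close>

lemma sum_le_path_gain:
  assumes w: "\<And>i j. i \<in> {1..M} \<Longrightarrow> j \<in> {1..N} \<Longrightarrow> 0 \<le> w i j"
  shows "(\<Sum>(i, j)\<in>A. w i j) \<le> path_gain k N (weight_walk M w) (\<lambda>p m. real (crossing p m) / real M)"
proof -
  have ind: "(\<Sum>p=1..k. if p \<le> level i j then x else 0) = real (level i j) * x" if "j \<le> N" for i j and x :: real
  proof -
    have "(\<Sum>p=1..k. if p \<le> level i j then x else 0) = (\<Sum>p\<in>{1..level i j}. x)"
      using level_le[OF that, of i] by (intro sum.mono_neutral_cong_right) auto
    then show ?thesis by simp
  qed
  have walk: "weight_walk M w j (real (crossing p m) / real M)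
      = (\<Sum>i=1..M. if p \<le> level i (nat (m + int p - 1)) then w i j else 0)" for j p m
  proof -
    have "nat \<lfloor>real M * (real (crossing p m) / real M)\<rfloor> = crossing p m" using M by simp
    then have "weight_walk M w j (real (crossing p m) / real M) = (\<Sum>i\<in>{1..crossing p m}. w i j)"
      by (simp add: weight_walk_def)
    also have "\<dots> = (\<Sum>i=1..M. if p \<le> level i (nat (m + int p - 1)) then w i j else 0)"
      unfolding crossing_set[symmetric] by (intro sum.mono_neutral_cong_left) auto
    finally show ?thesis .
  qed
  have "path_gain k N (weight_walk M w) (\<lambda>p m. real (crossing p m) / real M)
      = (\<Sum>j=1..N. \<Sum>p=1..k. (\<Sum>i=1..M. if p \<le> level i j then w i j else 0)
          - (\<Sum>i=1..M. if p \<le> level i (j - 1) then w i j else 0))"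
    unfolding path_gain_def walk by (intro sum.cong refl arg_cong2[where f="(-)"]) (auto simp: nat_diff_distrib')
  also have "\<dots> = (\<Sum>j=1..N. \<Sum>i=1..M. (\<Sum>p=1..k. if p \<le> level i j then w i j else 0)
          - (\<Sum>p=1..k. if p \<le> level i (j - 1) then w i j else 0))"
    unfolding sum_subtractf[symmetric] by (intro sum.cong refl sum.swap)
  also have "\<dots> = (\<Sum>j=1..N. \<Sum>i=1..M. (real (level i j) - real (level i (j - 1))) * w i j)"
    by (intro sum.cong refl) (subst ind, simp, subst ind, auto simp: algebra_simps)
  also have "\<dots> = (\<Sum>(i, j)\<in>{1..M} \<times> {1..N}. (real (level i j) - real (level i (j - 1))) * w i j)"
    by (subst sum.swap) (simp add: sum.cartesian_product)
  also have "\<dots> \<ge> (\<Sum>(i, j)\<in>A. (real (level i j) - real (level i (j - 1))) * w i j)"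
  proof (rule sum_mono2)
    fix x assume "x \<in> {1..M} \<times> {1..N} - A"
    then show "0 \<le> (case x of (i, j) \<Rightarrow> (real (level i j) - real (level i (j - 1))) * w i j)"
      using level_mono[OF order_refl, of "snd x - 1" "snd x" "fst x"] w by auto
  qed (use A in auto)
  moreover have "(\<Sum>(i, j)\<in>A. (real (level i j) - real (level i (j - 1))) * w i j) = (\<Sum>(i, j)\<in>A. w i j)"
  proof (intro sum.cong refl)
    fix x assume x: "x \<in> A"
    obtain i j where ij: "x = (i, Suc j)"
      using x A by (cases x, cases "snd x") auto
    show "(case x of (i, j) \<Rightarrow> (real (level i j) - real (level i (j - 1))) * w i j) = (case x of (i, j) \<Rightarrow> w i j)"
      using level_site[of i j] x ij by simp
  qed
  ultimately show ?thesis by linarith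
qed

end

section \<open>Replacing disjoint paths by an interlacing array\<close>

lemma ne_path_subset: "\<pi> \<in> ne_paths M N \<Longrightarrow> \<pi> \<subseteq> {1..M} \<times> {1..N}"
  by (auto simp: ne_paths_def)

lemma ne_path_chain:
  assumes "\<pi> \<in> ne_paths M N" "x \<in> \<pi>" "y \<in> \<pi>"
  shows "fst x \<le> fst y \<and> snd x \<le> snd y \<or> fst y \<le> fst x \<and> snd y \<le> snd x"
proof -
  define le where "le x y \<longleftrightarrow> fst x \<le> fst y \<and> snd x \<le> snd y" for x y :: "nat \<times> nat"
  obtain xs where xs: "\<pi> = set xs" "successively ne_step xs"
    using assms(1) unfolding ne_paths_def by blast
  have "successively le xs"
    by (rule successively_mono[OF xs(2)]) (auto simp: ne_step_def le_def)
  moreover have "transp le"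
    by (rule transpI) (use le_def order_trans in metis)
  ultimately have sorted: "sorted_wrt le xs"
    using successively_conv_sorted_wrt by blast
  obtain a where a: "a < length xs" "xs ! a = x"
    using assms(2) unfolding xs(1) in_set_conv_nth by blast
  obtain b where b: "b < length xs" "xs ! b = y"
    using assms(3) unfolding xs(1) in_set_conv_nth by blast
  have "le x y \<or> le y x"
  proof (cases a b rule: linorder_cases)
    case less then show ?thesis using sorted_wrt_nth_less[OF sorted less] a b by simp
  next
    case equal then show ?thesis using a b by (simp add: le_def)
  next
    case greater then show ?thesis using sorted_wrt_nth_less[OF sorted greater] a b by simp
  qed
  then show ?thesis unfolding le_def .
qed

text \<open>The columns in which a path moves vertically. There are boundedly many of them, whatever \<open>M\<close> is,
  so their sites can be discarded at a cost proportional to the largest weight.\<close>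

definition double_columns :: "(nat \<times> nat) set \<Rightarrow> nat set" where
  "double_columns \<pi> = {i. \<exists>j j'. j < j' \<and> (i, j) \<in> \<pi> \<and> (i, j') \<in> \<pi>}"

text \<open>The lowest row of the path strictly increases from one such column to the next, and there are only
  \<open>N\<close> rows.\<close>

lemma card_double_columns:
  assumes "\<pi> \<in> ne_paths M N"
  shows "finite (double_columns \<pi>)" "card (double_columns \<pi>) \<le> N"
proof -
  define g where "g i = Min {j. (i, j) \<in> \<pi>}" for i
  have fin: "finite {j. (i, j) \<in> \<pi>}" for i
  proof (rule finite_subset)
    show "{j. (i, j) \<in> \<pi>} \<subseteq> {1..N}" using ne_path_subset[OF assms] by blast
  qed simp
  have g_in: "(i, g i) \<in> \<pi>" if "i \<in> double_columns \<pi>" for i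
  proof -
    have "{j. (i, j) \<in> \<pi>} \<noteq> {}" using that unfolding double_columns_def by blast
    from Min_in[OF fin this] show ?thesis unfolding g_def by blast
  qed
  have less: "g i < g i'" if i: "i \<in> double_columns \<pi>" "i' \<in> double_columns \<pi>" "i < i'" for i i'
  proof -
    obtain j j' where j: "j < j'" "(i, j) \<in> \<pi>" "(i, j') \<in> \<pi>"
      using i(1) unfolding double_columns_def by blast
    have "j' \<le> g i'" using ne_path_chain[OF assms j(3) g_in[OF i(2)]] i(3) by simp
    moreover have "g i \<le> j" unfolding g_def by (rule Min_le[OF fin]) (use j(2) in simp)
    ultimately show ?thesis using j(1) by linarith
  qed
  have inj: "inj_on g (double_columns \<pi>)"
  proof (rule inj_onI)
    fix i i' assume i: "i \<in> double_columns \<pi>" "i' \<in> double_columns \<pi>" "g i = g i'"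
    show "i = i'"
      using less[OF i(1,2)] less[OF i(2,1)] i(3) by (metis less_irrefl linorder_neqE_nat)
  qed
  have ran: "g ` double_columns \<pi> \<subseteq> {1..N}"
  proof
    fix x assume "x \<in> g ` double_columns \<pi>"
    then obtain i where "(i, x) \<in> \<pi>" using g_in by blast
    then show "x \<in> {1..N}" using ne_path_subset[OF assms] by blast
  qed
  show "finite (double_columns \<pi>)" by (rule inj_on_finite[OF inj ran]) simp
  show "card (double_columns \<pi>) \<le> N" using card_inj_on_le[OF inj ran] by simp
qed

text \<open>Without the columns of vertical moves, the union of the paths contains no \<open>south_east\<close> chain of
  \<open>k + 1\<close> sites, because two sites of such a chain never lie on the same path. Hence the level
  construction applies to what is left.\<close>

lemma disjoint_paths_le_path_gain:
  assumes kN: "k \<le> N" and M: "1 \<le> M" and \<pi>: "\<And>p. p \<in> {1..k} \<Longrightarrow> \<pi> p \<in> ne_paths M N"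
    and w: "\<And>i j. i \<in> {1..M} \<Longrightarrow> j \<in> {1..N} \<Longrightarrow> 0 \<le> w i j \<and> w i j \<le> c"
  obtains s where "s \<in> interlacing k N"
    "(\<Sum>(i, j)\<in>(\<Union>p\<in>{1..k}. \<pi> p). w i j) \<le> path_gain k N (weight_walk M w) s + real k * real N * real N * c"
proof -
  define U where "U = (\<Union>p\<in>{1..k}. \<pi> p)"
  define D where "D = (\<Union>p\<in>{1..k}. double_columns (\<pi> p))"
  define A where "A = {x\<in>U. fst x \<notin> D}"
  have U: "U \<subseteq> {1..M} \<times> {1..N}"
    unfolding U_def using ne_path_subset[OF \<pi>] by blast
  then have fin: "finite U" using finite_subset by blast
  have A: "A \<subseteq> {1..M} \<times> {1..N}" using U by (auto simp: A_def)
  have width: "card T \<le> k" if T: "T \<subseteq> A" "south_east T" for T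
  proof -
    have "\<forall>x\<in>T. \<exists>p\<in>{1..k}. x \<in> \<pi> p" using T(1) by (auto simp: A_def U_def)
    then obtain f where f: "\<And>x. x \<in> T \<Longrightarrow> f x \<in> {1..k} \<and> x \<in> \<pi> (f x)" by metis
    have sep: "\<not> (fst x \<le> fst y \<and> snd y < snd x)" if "x \<in> T" "y \<in> T" "f x = f y" for x y
    proof
      assume *: "fst x \<le> fst y \<and> snd y < snd x"
      have p: "f x \<in> {1..k}" "x \<in> \<pi> (f x)" "y \<in> \<pi> (f x)" using f that by metis+
      have "fst x = fst y" using ne_path_chain[OF \<pi>[OF p(1)] p(2,3)] * by auto
      then have "fst x \<in> double_columns (\<pi> (f x))"
        using p * unfolding double_columns_def by (cases x; cases y) auto
      then show False using p(1) that(1) T(1) by (auto simp: A_def D_def)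
    qed
    have "inj_on f T"
    proof (rule inj_onI)
      fix x y assume xy: "x \<in> T" "y \<in> T" "f x = f y"
      show "x = y"
        using T(2)[unfolded south_east_def, rule_format, OF xy(1,2)] sep[OF xy] sep[of y x] xy by auto
    qed
    then have "card T \<le> card {1..k}" by (rule card_inj_on_le) (use f in auto)
    then show ?thesis by simp
  qed
  let ?s = "\<lambda>p m. real (crossing k M N A p m) / real M"
  have cD: "finite D \<and> card D \<le> k * N"
  proof
    show "finite D" unfolding D_def using card_double_columns(1)[OF \<pi>] by auto
    have "card D \<le> (\<Sum>p\<in>{1..k}. card (double_columns (\<pi> p)))"
      unfolding D_def by (rule card_UN_le) simp
    also have "\<dots> \<le> (\<Sum>p\<in>{1..k}. N)"
      by (intro sum_mono card_double_columns(2)[OF \<pi>])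
    finally show "card D \<le> k * N" by simp
  qed
  have s: "?s \<in> interlacing k N" by (rule crossing_interlacing[OF kN M A width])
  have "(\<Sum>(i, j)\<in>U. w i j) \<le> path_gain k N (weight_walk M w) ?s + real k * real N * real N * c"
  proof -
    have "A \<subseteq> U" by (auto simp: A_def)
    then have "(\<Sum>(i, j)\<in>U. w i j) = (\<Sum>(i, j)\<in>U - A. w i j) + (\<Sum>(i, j)\<in>A. w i j)"
      using fin by (rule sum.subset_diff)
    moreover have "(\<Sum>(i, j)\<in>A. w i j) \<le> path_gain k N (weight_walk M w) ?s"
      by (rule sum_le_path_gain[OF kN M A width]) (use w in auto)
    moreover have "(\<Sum>(i, j)\<in>U - A. w i j) \<le> real k * real N * real N * c"
    proof -
      have sub: "U - A \<subseteq> D \<times> {1..N}" using U by (auto simp: A_def)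
      show ?thesis
      proof (cases "U - A = {}")
        case True
        have "0 \<le> c" if "N \<noteq> 0" using w[of 1 1] M that by simp
        then have "0 \<le> real k * real N * real N * c" by (cases "N = 0") simp_all
        then show ?thesis unfolding True by simp
      next
        case False
        then obtain i j where "(i, j) \<in> U" by auto
        then have "i \<in> {1..M}" "j \<in> {1..N}" using U by auto
        then have c: "0 \<le> c" using w[of i j] by linarith
        have "card (U - A) \<le> card (D \<times> {1..N})"
          using sub cD by (intro card_mono) auto
        also have "\<dots> \<le> k * N * N" using cD by (simp add: card_cartesian_product)
        finally have "real (card (U - A)) \<le> real (k * N * N)" by (simp only: of_nat_le_iff)
        then have *: "real (card (U - A)) * c \<le> real k * real N * real N * c"
          using c by (simp add: mult_right_mono)
        have "(case x of (i, j) \<Rightarrow> w i j) \<le> c" if "x \<in> U - A" for x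
          using that U w[of "fst x" "snd x"] by (cases x) auto
        then have "(\<Sum>(i, j)\<in>U - A. w i j) \<le> real (card (U - A)) * c"
          by (rule sum_bounded_above)
        with * show ?thesis by linarith
      qed
    qed
    ultimately show ?thesis by linarith
  qed
  with s show ?thesis unfolding U_def by (rule that)
qed

section \<open>Replacing an interlacing array by disjoint paths\<close>

lemma successively_row: "successively ne_step (map (\<lambda>i. (i, j)) [a..<b])"
  by (auto simp: successively_conv_nth ne_step_def)

lemma staircase_list:
  assumes "\<And>r. r \<le> n \<Longrightarrow> t r \<le> (t (Suc r) :: nat)"
  shows "\<exists>xs. xs \<noteq> [] \<and> successively ne_step xs \<and> last xs = (t (Suc n), j + n) \<and>
    set xs = {(i, j + r) | i r. r \<le> n \<and> t r \<le> i \<and> i \<le> t (Suc r)}"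
  using assms
proof (induction n)
  case 0
  then show ?case
    by (intro exI[of _ "map (\<lambda>i. (i, j)) [t 0..<Suc (t 1)]"])
      (auto simp: successively_row last_map simp del: upt_Suc)
next
  case (Suc n)
  have "\<exists>xs. xs \<noteq> [] \<and> successively ne_step xs \<and> last xs = (t (Suc n), j + n) \<and>
    set xs = {(i, j + r) | i r. r \<le> n \<and> t r \<le> i \<and> i \<le> t (Suc r)}"
    by (rule Suc.IH) (use Suc.prems in simp)
  then obtain xs where xs: "xs \<noteq> []" "successively ne_step xs" "last xs = (t (Suc n), j + n)"
    "set xs = {(i, j + r) | i r. r \<le> n \<and> t r \<le> i \<and> i \<le> t (Suc r)}" by blast
  let ?ys = "map (\<lambda>i. (i, j + Suc n)) [t (Suc n)..<Suc (t (Suc (Suc n)))]"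
  have le: "t (Suc n) \<le> t (Suc (Suc n))" using Suc.prems by simp
  have hd: "hd ?ys = (t (Suc n), j + Suc n)" using le by (simp add: hd_map upt_rec)
  show ?case
  proof (intro exI[of _ "xs @ ?ys"] conjI)
    have "ne_step (last xs) (hd ?ys)" unfolding hd xs(3) by (simp add: ne_step_def)
    then show "successively ne_step (xs @ ?ys)"
      using xs(2) successively_row unfolding successively_append_iff by blast
    show "last (xs @ ?ys) = (t (Suc (Suc n)), j + Suc n)" using le by (simp add: last_map)
    have "set ?ys = {(i, j + Suc n) | i. t (Suc n) \<le> i \<and> i \<le> t (Suc (Suc n))}" by auto
    then show "set (xs @ ?ys) = {(i, j + r) | i r. r \<le> Suc n \<and> t r \<le> i \<and> i \<le> t (Suc r)}"
      unfolding set_append xs(4) by (auto simp: le_Suc_eq)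
  qed (use xs in simp_all)
qed

text \<open>Path \<open>p\<close> runs along row \<open>j\<close> between its entries with indices \<open>j - p\<close> and \<open>j - p + 1\<close> and climbs to the next
  row there. Neighbouring paths of an interlacing array may climb in the same column and would then
  share a site, so the entries are first separated by shifts of at most \<open>k\<close>.\<close>

lemma path_gain_le_disjoint_paths:
  assumes k: "1 \<le> k" and kN: "k \<le> N" and kM: "k \<le> M" and s: "s \<in> interlacing k N"
    and w: "\<And>i j. i \<in> {1..M} \<Longrightarrow> j \<in> {1..N} \<Longrightarrow> 0 \<le> w i j \<and> w i j \<le> c"
  obtains \<pi> where "\<forall>p\<in>{1..k}. \<pi> p \<in> ne_paths M N" "disjoint_family_on \<pi> {1..k}"
    "path_gain k N (weight_walk M w) s \<le> (\<Sum>(i, j)\<in>(\<Union>p\<in>{1..k}. \<pi> p). w i j) + 2 * real k * real k * real N * c"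
proof -
  have c: "0 \<le> c" using w[of 1 1] k kN kM by force
  define S where "S p m = nat \<lfloor>real M * s p m\<rfloor>" for p m
  \<comment> \<open>Cutting off at \<open>M - k\<close> leaves room on the right for the shifts \<open>k - p + 1\<close>, which decrease strictly in \<open>p\<close>;
    the boundary values 1 and \<open>M\<close> are the first and the last column.\<close>
  define T where "T p m = (if m \<le> 0 then 1 else if m \<ge> int N - int k + 1 then M
    else min (S p m) (M - k) + (k - p + 1))" for p m
  define \<pi> where "\<pi> p = {(i, j). p \<le> j \<and> j \<le> p + (N - k) \<and>
    T p (int j - int p) \<le> i \<and> i \<le> T p (int j - int p + 1)}" for p
  have S_mono: "S p m \<le> S p (m + 1)" if "p \<in> {1..k}" for p m
  proof -
    have "s p m \<le> s p (m + 1)" using s that unfolding interlacing_def by blast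
    then show ?thesis unfolding S_def by (intro nat_mono floor_mono mult_left_mono) simp_all
  qed
  have S_p: "S (Suc p) m \<le> S p m" if "1 \<le> p" "p + 1 \<le> k" for p m
  proof -
    have "s (p + 1) m \<le> s p m" using s that unfolding interlacing_def by blast
    then show ?thesis unfolding S_def by (intro nat_mono floor_mono mult_left_mono) simp_all
  qed
  have S_anti: "S q m \<le> S p m" if "p \<le> q" "1 \<le> p" "q \<le> k" for p q m
    using that
  proof (induction q rule: dec_induct)
    case (step q) then show ?case using S_p[of q m] by auto
  qed simp
  have S_0: "S p m = 0" if "p \<in> {1..k}" "m \<le> 0" for p m
  proof -
    have "s p m = 0" using s that unfolding interlacing_def by blast
    then show ?thesis by (simp add: S_def)
  qed
  have S_1: "S p m = M" if "p \<in> {1..k}" "int N - int k + 1 \<le> m" for p m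
  proof -
    have "s p m = 1" using s that unfolding interlacing_def by blast
    then show ?thesis by (simp add: S_def)
  qed
  have S_le: "S p m \<le> M" if "p \<in> {1..k}" for p m
  proof -
    have "real M * s p m \<le> real M" using interlacing_range[OF s that] by (intro mult_left_le) auto
    then show ?thesis unfolding S_def by linarith
  qed
  have T_range: "T p m \<in> {1..M}" if "p \<in> {1..k}" for p m
    using that k kM by (auto simp: T_def)
  have T_mono: "T p m \<le> T p (m + 1)" if "p \<in> {1..k}" for p m
  proof -
    consider "m \<le> 0" | "int N - int k + 1 \<le> m + 1" "0 < m" | "0 < m" "m + 1 < int N - int k + 1" by linarith
    then show ?thesis
    proof cases
      case 1
      then have "T p m = 1" by (simp add: T_def)
      then show ?thesis using T_range[OF that, of "m + 1"] by simp
    next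
      case 2
      then have "T p (m + 1) = M" by (simp add: T_def)
      then show ?thesis using T_range[OF that, of m] by simp
    next
      case 3
      then show ?thesis using S_mono[OF that, of m] by (simp add: T_def min_le_iff_disj)
    qed
  qed
  have T_lo: "T p m \<le> S p m + k" if "p \<in> {1..k}" for p m
  proof (cases "0 < m \<and> m < int N - int k + 1")
    case True
    then have "T p m = min (S p m) (M - k) + (k - p + 1)" by (simp add: T_def)
    then show ?thesis using that by auto
  next
    case False
    then show ?thesis using S_1[OF that, of m] k by (cases "m \<le> 0") (simp_all add: T_def)
  qed
  have T_hi: "S p m \<le> T p m + k" if "p \<in> {1..k}" for p m
  proof (cases "0 < m \<and> m < int N - int k + 1")
    case True
    then have "T p m = min (S p m) (M - k) + (k - p + 1)" by (simp add: T_def)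
    then show ?thesis using S_le[OF that, of m] by linarith
  next
    case False
    then show ?thesis using S_0[OF that, of m] S_le[OF that, of m]
      by (cases "m \<le> 0") (simp_all add: T_def)
  qed
  have path: "\<pi> p \<in> ne_paths M N" if p: "p \<in> {1..k}" for p
  proof -
    obtain xs where xs: "xs \<noteq> []" "successively ne_step xs"
      "set xs = {(i, p + r) | i r. r \<le> N - k \<and> T p (int r) \<le> i \<and> i \<le> T p (int (Suc r))}"
    proof -
      have "T p (int r) \<le> T p (int (Suc r))" for r
        using T_mono[OF p, of "int r"] by (simp add: add.commute)
      from staircase_list[of "N - k" "\<lambda>r. T p (int r)" p, OF this] show ?thesis using that by blast
    qed
    have "\<pi> p = set xs"
    proof (intro set_eqI iffI)
      fix x assume "x \<in> \<pi> p"
      then obtain i j where x: "x = (i, j)" "p \<le> j" "j \<le> p + (N - k)"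
        "T p (int j - int p) \<le> i" "i \<le> T p (int j - int p + 1)" by (auto simp: \<pi>_def)
      then have "x = (i, p + (j - p)) \<and> j - p \<le> N - k \<and> T p (int (j - p)) \<le> i \<and> i \<le> T p (int (Suc (j - p)))"
        by (auto simp: of_nat_diff algebra_simps)
      then show "x \<in> set xs" unfolding xs(3) by blast
    next
      fix x assume "x \<in> set xs"
      then show "x \<in> \<pi> p" unfolding xs(3) \<pi>_def by (auto simp: algebra_simps)
    qed
    moreover have "set xs \<subseteq> {1..M} \<times> {1..N}"
    proof
      fix x assume "x \<in> set xs"
      then obtain i r where x: "x = (i, p + r)" "r \<le> N - k" "T p (int r) \<le> i" "i \<le> T p (int (Suc r))"
        unfolding xs(3) by auto
      then show "x \<in> {1..M} \<times> {1..N}"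
        using T_range[OF p, of "int r"] T_range[OF p, of "int (Suc r)"] p kN by auto
    qed
    ultimately show ?thesis unfolding ne_paths_def using xs(1,2) by blast
  qed
  have disj: "\<pi> p \<inter> \<pi> q = {}" if pq: "p \<in> {1..k}" "q \<in> {1..k}" "p < q" for p q
  proof -
    have False if "(i, j) \<in> \<pi> p" "(i, j) \<in> \<pi> q" for i j
    proof -
      have j: "q \<le> j" "j \<le> p + (N - k)" and i: "T p (int j - int p) \<le> i" "i \<le> T q (int j - int q + 1)"
        using that by (auto simp: \<pi>_def)
      have m: "0 < int j - int p" "int j - int p < int N - int k + 1" "int j - int q + 1 \<le> int j - int p"
        using j pq kN by auto
      have "T q (int j - int q + 1) < T p (int j - int p)"
      proof -
        have "S q (int j - int q + 1) \<le> S q (int j - int p)"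
        proof -
          have "S q m \<le> S q (m + int n)" for m n
          proof (induction n)
            case (Suc n) then show ?case using S_mono[OF pq(2), of "m + int n"] by (simp add: algebra_simps)
          qed simp
          from this[of "int j - int q + 1" "q - p - 1"] show ?thesis using pq by (simp add: of_nat_diff)
        qed
        also have "\<dots> \<le> S p (int j - int p)" using S_anti[of p q] pq by auto
        finally show ?thesis using m pq j by (auto simp: T_def)
      qed
      then show False using i by linarith
    qed
    then show ?thesis by auto
  qed
  have walk: "weight_walk M w j (s p m) = (\<Sum>i\<in>{1..S p m}. w i j)" for j p m
    by (simp add: weight_walk_def S_def)
  have step: "weight_walk M w j (s p (int j - int p + 1)) - weight_walk M w j (s p (int j - int p))
      \<le> (\<Sum>i=1..M. if (i, j) \<in> \<pi> p then w i j else 0) + 2 * real k * c"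
    if jp: "j \<in> {1..N}" "p \<in> {1..k}" for j p
  proof -
    define lo hi where "lo = S p (int j - int p)" and "hi = S p (int j - int p + 1)"
    have lh: "lo \<le> hi" "hi \<le> M" unfolding lo_def hi_def using S_mono S_le jp by auto
    have "(\<Sum>i\<in>{1..hi}. w i j) - (\<Sum>i\<in>{1..lo}. w i j) = (\<Sum>i\<in>{lo<..hi}. w i j)"
    proof -
      have "{1..hi} = {1..lo} \<union> {lo<..hi}" using lh by auto
      then have "(\<Sum>i\<in>{1..hi}. w i j) = (\<Sum>i\<in>{1..lo}. w i j) + (\<Sum>i\<in>{lo<..hi}. w i j)"
        by (simp only:) (intro sum.union_disjoint; auto)
      then show ?thesis by simp
    qed
    also have "(\<Sum>i\<in>{lo<..hi}. w i j) \<le> (\<Sum>i\<in>{lo<..hi}. (if (i, j) \<in> \<pi> p then w i j else 0)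
        + ((if i \<in> {lo<..lo + k} then c else 0) + (if i \<in> {hi - k<..hi} then c else 0)))"
    proof (rule sum_mono)
      fix i assume i: "i \<in> {lo<..hi}"
      then have wi: "0 \<le> w i j" "w i j \<le> c" using w[of i j] jp lh by auto
      have "p \<le> j" "j \<le> p + (N - k)"
      proof -
        show "p \<le> j"
        proof (rule ccontr)
          assume "\<not> p \<le> j" then have "hi = 0" unfolding hi_def using S_0 jp by auto
          then show False using i by auto
        qed
        show "j \<le> p + (N - k)"
        proof (rule ccontr)
          assume "\<not> j \<le> p + (N - k)" then have "lo = M" unfolding lo_def using S_1 jp kN by auto
          then show False using i lh by auto
        qed
      qed
      have near_lo: "i \<in> {lo<..lo + k}" if "i < T p (int j - int p)"
        using that i T_lo[OF jp(2), of "int j - int p"] by (auto simp: lo_def)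
      have near_hi: "i \<in> {hi - k<..hi}" if "T p (int j - int p + 1) < i"
        using that i T_hi[OF jp(2), of "int j - int p + 1"] by (auto simp: hi_def)
      show "w i j \<le> (if (i, j) \<in> \<pi> p then w i j else 0)
        + ((if i \<in> {lo<..lo + k} then c else 0) + (if i \<in> {hi - k<..hi} then c else 0))"
      proof (cases "(i, j) \<in> \<pi> p")
        case True
        then show ?thesis using c by simp
      next
        case False
        then have "i < T p (int j - int p) \<or> T p (int j - int p + 1) < i"
          using \<open>p \<le> j\<close> \<open>j \<le> p + (N - k)\<close> by (auto simp: \<pi>_def)
        then have "i \<in> {lo<..lo + k} \<or> i \<in> {hi - k<..hi}" using near_lo near_hi by blast
        then show ?thesis using wi c False by auto
      qed
    qed
    finally have "(\<Sum>i\<in>{1..hi}. w i j) - (\<Sum>i\<in>{1..lo}. w i j)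
      \<le> (\<Sum>i\<in>{lo<..hi}. (if (i, j) \<in> \<pi> p then w i j else 0))
        + ((\<Sum>i\<in>{lo<..hi}. (if i \<in> {lo<..lo + k} then c else 0)) + (\<Sum>i\<in>{lo<..hi}. (if i \<in> {hi - k<..hi} then c else 0)))"
      by (simp only: sum.distrib)
    moreover have "(\<Sum>i\<in>{lo<..hi}. (if (i, j) \<in> \<pi> p then w i j else 0)) \<le> (\<Sum>i=1..M. if (i, j) \<in> \<pi> p then w i j else 0)"
      using lh w jp by (intro sum_mono2) auto
    moreover have "(\<Sum>i\<in>{lo<..hi}. (if i \<in> {lo<..lo + k} then c else 0)) \<le> real k * c"
    proof -
      have "card ({lo<..hi} \<inter> {lo<..lo + k}) \<le> card {lo<..lo + k}" by (intro card_mono) auto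
      then show ?thesis using c by (simp add: sum.inter_restrict[symmetric] mult_right_mono del: greaterThanAtMost_iff)
    qed
    moreover have "(\<Sum>i\<in>{lo<..hi}. (if i \<in> {hi - k<..hi} then c else 0)) \<le> real k * c"
    proof -
      have "card ({lo<..hi} \<inter> {hi - k<..hi}) \<le> card {hi - k<..hi}" by (intro card_mono) auto
      then show ?thesis using c by (simp add: sum.inter_restrict[symmetric] mult_right_mono del: greaterThanAtMost_iff)
    qed
    ultimately have "(\<Sum>i\<in>{1..hi}. w i j) - (\<Sum>i\<in>{1..lo}. w i j)
      \<le> (\<Sum>i=1..M. if (i, j) \<in> \<pi> p then w i j else 0) + 2 * real k * c" by linarith
    then show ?thesis unfolding walk lo_def hi_def .
  qed
  show ?thesis
  proof (rule that)
    show "\<forall>p\<in>{1..k}. \<pi> p \<in> ne_paths M N" using path by blast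
    show "disjoint_family_on \<pi> {1..k}"
      unfolding disjoint_family_on_def
    proof (intro ballI impI)
      fix p q assume pq: "p \<in> {1..k}" "q \<in> {1..k}" "p \<noteq> q"
      show "\<pi> p \<inter> \<pi> q = {}"
        using disj[OF pq(1,2)] disj[OF pq(2,1)] pq(3) by (cases "p < q") auto
    qed
    have fin: "finite (\<pi> p)" if "p \<in> {1..k}" for p
      using ne_path_subset[OF path[OF that]] finite_subset by blast
    have "path_gain k N (weight_walk M w) s
      \<le> (\<Sum>j=1..N. \<Sum>p=1..k. (\<Sum>i=1..M. if (i, j) \<in> \<pi> p then w i j else 0) + 2 * real k * c)"
      unfolding path_gain_def by (intro sum_mono step)
    also have "\<dots> = (\<Sum>j=1..N. \<Sum>p=1..k. \<Sum>i=1..M. if (i, j) \<in> \<pi> p then w i j else 0) + 2 * real k * real k * real N * c"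
      by (simp add: sum.distrib)
    also have "(\<Sum>j=1..N. \<Sum>p=1..k. \<Sum>i=1..M. if (i, j) \<in> \<pi> p then w i j else 0)
        = (\<Sum>p=1..k. \<Sum>i=1..M. \<Sum>j=1..N. if (i, j) \<in> \<pi> p then w i j else 0)"
      by (subst sum.swap) (intro sum.cong refl sum.swap)
    also have "\<dots> = (\<Sum>p=1..k. \<Sum>(i, j)\<in>\<pi> p. w i j)"
    proof (intro sum.cong refl)
      fix p assume p: "p \<in> {1..k}"
      have "(\<Sum>i=1..M. \<Sum>j=1..N. if (i, j) \<in> \<pi> p then w i j else 0)
          = (\<Sum>x\<in>{1..M} \<times> {1..N}. if x \<in> \<pi> p then (case x of (i, j) \<Rightarrow> w i j) else 0)"
        by (simp add: sum.cartesian_product) (intro sum.cong; auto)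
      also have "\<dots> = (\<Sum>(i, j)\<in>\<pi> p. w i j)"
        using ne_path_subset[OF path[OF p]] by (intro sum.mono_neutral_cong_right) auto
      finally show "(\<Sum>i=1..M. \<Sum>j=1..N. if (i, j) \<in> \<pi> p then w i j else 0) = (\<Sum>(i, j)\<in>\<pi> p. w i j)" .
    qed
    also have "\<dots> = (\<Sum>(i, j)\<in>(\<Union>p\<in>{1..k}. \<pi> p). w i j)"
    proof (rule sum.UNION_disjoint[symmetric])
      show "\<forall>i\<in>{1..k}. finite (\<pi> i)" using fin by blast
      show "\<forall>i\<in>{1..k}. \<forall>j\<in>{1..k}. i \<noteq> j \<longrightarrow> \<pi> i \<inter> \<pi> j = {}"
        using disj by (metis Int_commute linorder_neqE_nat)
    qed simp
    finally show "path_gain k N (weight_walk M w) s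
      \<le> (\<Sum>(i, j)\<in>(\<Union>p\<in>{1..k}. \<pi> p). w i j) + 2 * real k * real k * real N * c" .
  qed
qed

section \<open>The maximum as the functional of the row walks\<close>

definition path_unions :: "nat \<Rightarrow> nat \<Rightarrow> nat \<Rightarrow> (nat \<times> nat) set set" where
  "path_unions k M N = {\<Union>p\<in>{1..k}. \<pi> p | \<pi>.
     (\<forall>p\<in>{1..k}. \<pi> p \<in> ne_paths M N) \<and> disjoint_family_on \<pi> {1..k}}"

lemma path_unions_subset: "A \<in> path_unions k M N \<Longrightarrow> A \<subseteq> {1..M} \<times> {1..N}"
  unfolding path_unions_def using ne_path_subset by blast

lemma finite_path_unions: "finite (path_unions k M N)"
proof (rule finite_subset)
  show "path_unions k M N \<subseteq> Pow ({1..M} \<times> {1..N})" by (intro subsetI PowI path_unions_subset)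
qed simp

lemma H_eq: "H k M N w = Max ((\<lambda>A. \<Sum>(i, j)\<in>A. w i j) ` path_unions k M N)"
  unfolding H_def path_unions_def by (rule arg_cong[where f=Max]) auto

text \<open>The deterministic core: for nonnegative weights, the centred maximum is \<open>Omega\<close> evaluated at the
  centred row walks, up to the bound \<open>c / sqrt M\<close> on the rescaled weights times a factor independent of \<open>M\<close>.\<close>

theorem H_approx:
  assumes k: "1 \<le> k" and kN: "k \<le> N" and kM: "k \<le> M"
    and w: "\<And>i j. i \<in> {1..M} \<Longrightarrow> j \<in> {1..N} \<Longrightarrow> 0 \<le> w i j \<and> w i j \<le> c"
  shows "\<bar>(H k M N w - real k * real M) / sqrt (real M) - Omega k N (rescaled_walk M w)\<bar>
    \<le> 2 * (real N) ^ 3 * (c / sqrt (real M))"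
proof -
  have M: "1 \<le> M" using k kM by simp
  have c: "0 \<le> c" using w[of 1 1] k kN kM by force
  have sq: "sqrt (real M) > 0" using M by simp
  let ?C = "2 * (real N) ^ 3 * c"
  have C1: "real k * real N * real N * c \<le> ?C"
  proof -
    have "real k * real N * real N \<le> real N * real N * real N" using kN by (intro mult_right_mono) auto
    also have "\<dots> \<le> 2 * real N ^ 3" by (simp add: power3_eq_cube)
    finally show ?thesis using c by (intro mult_right_mono) auto
  qed
  have C2: "2 * real k * real k * real N * c \<le> ?C"
  proof -
    have "2 * (real k * real k) * real N \<le> 2 * (real N * real N) * real N"
      using kN by (intro mult_right_mono mult_left_mono mult_mono) auto
    then show ?thesis using c by (intro mult_right_mono) (auto simp: power3_eq_cube algebra_simps)
  qed
  have low: "path_gain k N (weight_walk M w) s \<le> H k M N w + ?C" if s: "s \<in> interlacing k N" for s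
  proof -
    obtain \<pi> where \<pi>: "\<forall>p\<in>{1..k}. \<pi> p \<in> ne_paths M N" "disjoint_family_on \<pi> {1..k}"
      "path_gain k N (weight_walk M w) s \<le> (\<Sum>(i, j)\<in>(\<Union>p\<in>{1..k}. \<pi> p). w i j) + 2 * real k * real k * real N * c"
      by (rule path_gain_le_disjoint_paths[OF k kN kM s w])
    have "(\<Union>p\<in>{1..k}. \<pi> p) \<in> path_unions k M N" unfolding path_unions_def using \<pi> by blast
    then have "(\<Sum>(i, j)\<in>(\<Union>p\<in>{1..k}. \<pi> p). w i j) \<le> H k M N w"
      unfolding H_eq by (intro Max_ge finite_imageI finite_path_unions) blast
    then show ?thesis using \<pi>(3) C2 by linarith
  qed
  obtain s0 where s0: "s0 \<in> interlacing k N" using interlacing_nonempty[OF kN] by auto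
  have ne: "path_unions k M N \<noteq> {}"
  proof -
    obtain \<pi> where \<pi>: "\<forall>p\<in>{1..k}. \<pi> p \<in> ne_paths M N" "disjoint_family_on \<pi> {1..k}"
      "path_gain k N (weight_walk M w) s0 \<le> (\<Sum>(i, j)\<in>(\<Union>p\<in>{1..k}. \<pi> p). w i j) + 2 * real k * real k * real N * c"
      by (rule path_gain_le_disjoint_paths[OF k kN kM s0 w])
    then show ?thesis unfolding path_unions_def by blast
  qed
  have "H k M N w \<in> (\<lambda>A. \<Sum>(i, j)\<in>A. w i j) ` path_unions k M N"
    unfolding H_eq using ne by (intro Max_in finite_imageI finite_path_unions) auto
  then obtain \<pi> where \<pi>: "\<And>p. p \<in> {1..k} \<Longrightarrow> \<pi> p \<in> ne_paths M N"
    "H k M N w = (\<Sum>(i, j)\<in>(\<Union>p\<in>{1..k}. \<pi> p). w i j)"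
    unfolding path_unions_def by blast
  obtain s where s: "s \<in> interlacing k N"
    "(\<Sum>(i, j)\<in>(\<Union>p\<in>{1..k}. \<pi> p). w i j) \<le> path_gain k N (weight_walk M w) s + real k * real N * real N * c"
    by (rule disjoint_paths_le_path_gain[OF kN M \<pi>(1) w])
  have div: "(a - b) / sqrt (real M) \<le> (d - b) / sqrt (real M) + 2 * (real N) ^ 3 * (c / sqrt (real M))"
    if "a \<le> d + ?C" for a b d :: real
  proof -
    have "(a - b) / sqrt (real M) \<le> (d - b + ?C) / sqrt (real M)"
      using that sq by (intro divide_right_mono) auto
    then show ?thesis by (simp add: add_divide_distrib)
  qed
  have le: "path_gain k N (rescaled_walk M w) s \<le>
    (H k M N w - real k * real M) / sqrt (real M) + 2 * (real N) ^ 3 * (c / sqrt (real M))"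
    if "s \<in> interlacing k N" for s
    unfolding path_gain_rescaled_walk[OF kN that] by (rule div[OF low[OF that]])
  have "Omega k N (rescaled_walk M w) \<le>
    (H k M N w - real k * real M) / sqrt (real M) + 2 * (real N) ^ 3 * (c / sqrt (real M))"
    unfolding Omega_eq by (rule cSUP_least[OF interlacing_nonempty[OF kN] le])
  moreover have "path_gain k N (rescaled_walk M w) s \<le> Omega k N (rescaled_walk M w)"
    unfolding Omega_eq by (rule cSUP_upper[OF s(1) bdd_aboveI2[OF le]])
  moreover have "(H k M N w - real k * real M) / sqrt (real M) \<le>
    path_gain k N (rescaled_walk M w) s + 2 * (real N) ^ 3 * (c / sqrt (real M))"
    unfolding path_gain_rescaled_walk[OF kN s(1)] using s(2) \<pi>(2) C1 by (intro div) linarith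
  ultimately show ?thesis by (simp add: abs_le_iff)
qed

section \<open>Sampling on a grid\<close>

definition grid_floor :: "nat \<Rightarrow> real \<Rightarrow> real" where
  "grid_floor L t = real (nat \<lfloor>real L * t\<rfloor>) / real L"

definition step_path :: "nat \<Rightarrow> (nat \<times> nat \<Rightarrow> real) \<Rightarrow> nat \<Rightarrow> real \<Rightarrow> real" where
  "step_path L v j t = (\<Sum>l<nat \<lfloor>real L * t\<rfloor>. v (j, l))"

lemma nat_floor_le: "t \<in> {0..1} \<Longrightarrow> nat \<lfloor>real L * t\<rfloor> \<le> L"
proof -
  assume "t \<in> {0..1}"
  then have "real L * t \<le> real L" by (intro mult_left_le) auto
  then show ?thesis by linarith
qed

lemma grid_floor_range: "t \<in> {0..1} \<Longrightarrow> grid_floor L t \<in> {0..1}"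
  using nat_floor_le[of t L] by (auto simp: grid_floor_def divide_simps)

lemma grid_floor_dist:
  assumes "L \<ge> 1" "t \<in> {0..1}"
  shows "\<bar>t - grid_floor L t\<bar> \<le> 1 / real L"
proof -
  have "0 \<le> real L * t" using assms by simp
  then have "\<bar>real L * t - real (nat \<lfloor>real L * t\<rfloor>)\<bar> \<le> 1" by linarith
  moreover have "t - grid_floor L t = (real L * t - real (nat \<lfloor>real L * t\<rfloor>)) / real L"
    using assms by (simp add: grid_floor_def field_simps)
  ultimately have "\<bar>t - grid_floor L t\<bar> = \<bar>real L * t - real (nat \<lfloor>real L * t\<rfloor>)\<bar> / real L"
    by (simp add: abs_divide)
  also have "\<dots> \<le> 1 / real L"
    using \<open>\<bar>real L * t - real (nat \<lfloor>real L * t\<rfloor>)\<bar> \<le> 1\<close> by (rule divide_right_mono) simp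
  finally show ?thesis .
qed

lemma step_path_abs_le:
  assumes "j \<in> {1..N}" "t \<in> {0..1}"
  shows "\<bar>step_path L v j t\<bar> \<le> (\<Sum>i\<in>{1..N} \<times> {..<L}. \<bar>v i\<bar>)"
proof -
  have "\<bar>step_path L v j t\<bar> \<le> (\<Sum>l<nat \<lfloor>real L * t\<rfloor>. \<bar>v (j, l)\<bar>)"
    unfolding step_path_def by (rule sum_abs)
  also have "\<dots> = (\<Sum>i\<in>{j} \<times> {..<nat \<lfloor>real L * t\<rfloor>}. \<bar>v i\<bar>)"
    using sum.cartesian_product[of "\<lambda>j l. \<bar>v (j, l)\<bar>" "{..<nat \<lfloor>real L * t\<rfloor>}" "{j}"] by (simp add: split_def)
  also have "\<dots> \<le> (\<Sum>i\<in>{1..N} \<times> {..<L}. \<bar>v i\<bar>)"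
    using nat_floor_le[OF assms(2), of L] assms(1) by (intro sum_mono2) auto
  finally show ?thesis .
qed

text \<open>Restricted to a grid, \<open>Omega\<close> depends on finitely many increments only.\<close>

lemma Omega_grid_floor:
  assumes L: "L \<ge> 1" and b0: "\<And>j. j \<in> {1..N} \<Longrightarrow> b j 0 = 0"
  shows "Omega k N (\<lambda>j t. b j (grid_floor L t))
    = Omega k N (step_path L (\<lambda>(j, l). b j (real (Suc l) / real L) - b j (real l / real L)))"
proof (rule Omega_cong)
  fix j t assume j: "j \<in> {1..N}"
  have "(\<Sum>l<n. b j (real (Suc l) / real L) - b j (real l / real L)) = b j (real n / real L)" for n
    by (subst sum_lessThan_telescope) (simp add: b0[OF j])
  then show "b j (grid_floor L t) = step_path L (\<lambda>(j, l). b j (real (Suc l) / real L) - b j (real l / real L)) j t"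
    by (simp add: grid_floor_def step_path_def)
qed

lemma continuous_Omega_step_path:
  assumes "k \<le> N" and v: "\<And>i. i \<in> {1..N} \<times> {..<L} \<Longrightarrow> (\<lambda>n. v n i) \<longlonglongrightarrow> u i"
  shows "(\<lambda>n. Omega k N (step_path L (v n))) \<longlonglongrightarrow> Omega k N (step_path L u)"
proof -
  let ?d = "\<lambda>n. \<Sum>i\<in>{1..N} \<times> {..<L}. \<bar>v n i - u i\<bar>"
  have "?d \<longlonglongrightarrow> (\<Sum>i\<in>{1..N} \<times> {..<L}. 0)"
    using v by (intro tendsto_sum tendsto_rabs_zero) (simp add: LIM_zero_iff)
  then have lim: "(\<lambda>n. 2 * real N * real k * ?d n) \<longlonglongrightarrow> 0"
    by (intro tendsto_mult_right_zero) simp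
  show ?thesis
  proof (rule LIM_zero_cancel, rule Lim_null_comparison[OF _ lim], rule always_eventually, rule allI)
    fix n
    have "\<bar>step_path L (v n) j t - step_path L u j t\<bar> \<le> ?d n" if "j \<in> {1..N}" "t \<in> {0..1}" for j t
      using step_path_abs_le[OF that, of L "\<lambda>i. v n i - u i"] by (simp add: step_path_def sum_subtractf)
    then show "norm (Omega k N (step_path L (v n)) - Omega k N (step_path L u)) \<le> 2 * real N * real k * ?d n"
      unfolding real_norm_def
      by (intro Omega_abs_diff_le[OF \<open>k \<le> N\<close> step_path_abs_le step_path_abs_le])
  qed
qed

text \<open>On step functions the supremum over the uncountable set of interlacing arrays only involves finitely
  many functionals, since an array matters only through the grid cells containing its entries.\<close>

lemma measurable_Omega_step_path:
  assumes "k \<le> N"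
  shows "(\<lambda>v. Omega k N (step_path L v)) \<in> borel_measurable (PiM ({1..N} \<times> {..<L}) (\<lambda>_. borel))"
proof -
  define F where "F s v = path_gain k N (step_path L v) s" for s v
  define a where "a s = (\<lambda>(j, p, m)\<in>{1..N} \<times> {1..k} \<times> {0..1}. nat \<lfloor>real L * s p (int j - int p + m)\<rfloor>)"
    for s :: "nat \<Rightarrow> int \<Rightarrow> real"
  define \<Phi> where "\<Phi> c v = (\<Sum>j=1..N. \<Sum>p=1..k. (\<Sum>l<c (j, p, 1::int). v (j, l)) - (\<Sum>l<c (j, p, 0). v (j, l)))"
    for c and v :: "nat \<times> nat \<Rightarrow> real"
  have F: "F s = \<Phi> (a s)" for s
    unfolding F_def \<Phi>_def path_gain_def step_path_def a_def
    by (intro ext sum.cong refl) simp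
  have "a ` interlacing k N \<subseteq> PiE ({1..N} \<times> {1..k} \<times> {0..1}) (\<lambda>_. {..L})"
  proof (intro image_subsetI PiE_I)
    fix s x assume s: "s \<in> interlacing k N" and x: "x \<in> {1..N} \<times> {1..k} \<times> {0..1::int}"
    obtain j p m where jpm: "x = (j, p, m)" by (cases x)
    then have p: "p \<in> {1..k}" using x by blast
    have "a s x = nat \<lfloor>real L * s p (int j - int p + m)\<rfloor>" using x unfolding a_def jpm by simp
    then show "a s x \<in> {..L}" using nat_floor_le[OF interlacing_range[OF s p]] by simp
  qed (simp add: a_def)
  then have "finite (a ` interlacing k N)"
    by (rule finite_subset) (intro finite_PiE; simp)
  then have fin: "finite (F ` interlacing k N)"
    unfolding F image_image[symmetric, of \<Phi> a] by simp
  have "(\<lambda>v. SUP f\<in>F ` interlacing k N. f v) \<in> borel_measurable (PiM ({1..N} \<times> {..<L}) (\<lambda>_. borel))"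
  proof (rule borel_measurable_cSUP)
    show "countable (F ` interlacing k N)" using fin by (rule countable_finite)
    fix f assume "f \<in> F ` interlacing k N"
    then obtain s where s: "s \<in> interlacing k N" "f = F s" by blast
    have meas: "(\<lambda>v. step_path L v j (s p m)) \<in> borel_measurable (PiM ({1..N} \<times> {..<L}) (\<lambda>_. borel))"
      if "j \<in> {1..N}" "p \<in> {1..k}" for j p m
      unfolding step_path_def
      using that nat_floor_le[OF interlacing_range[OF s(1) that(2)], of L m]
      by (intro borel_measurable_sum measurable_component_singleton) auto
    show "f \<in> borel_measurable (PiM ({1..N} \<times> {..<L}) (\<lambda>_. borel))"
      unfolding s(2) F_def path_gain_def
      by (intro borel_measurable_sum borel_measurable_diff meas)
  next
    fix v show "bdd_above ((\<lambda>f. f v) ` F ` interlacing k N)"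
      by (intro bdd_above_finite finite_imageI fin)
  qed
  then show ?thesis
    unfolding Omega_eq F_def[symmetric] by (simp add: image_image)
qed

lemma Omega_grid_approx:
  assumes "k \<le> N" and b: "\<And>j. j \<in> {1..N} \<Longrightarrow> continuous_on {0..1} (b j)"
  shows "(\<lambda>L. Omega k N (\<lambda>j t. b j (grid_floor L t))) \<longlonglongrightarrow> Omega k N b"
proof -
  have "\<forall>j\<in>{1..N}. \<exists>K. \<forall>t\<in>{0..1}. \<bar>b j t\<bar> \<le> K"
    using compact_imp_bounded[OF compact_continuous_image[OF b compact_Icc]]
    unfolding bounded_iff by fastforce
  then obtain K where K: "\<And>j t. j \<in> {1..N} \<Longrightarrow> t \<in> {0..1} \<Longrightarrow> \<bar>b j t\<bar> \<le> K j" by metis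
  define K' where "K' = (\<Sum>j=1..N. \<bar>K j\<bar>)"
  have K': "\<bar>b j t\<bar> \<le> K'" if "j \<in> {1..N}" "t \<in> {0..1}" for j t
    using K[OF that] member_le_sum[of j "{1..N}" "\<lambda>j. \<bar>K j\<bar>"] that unfolding K'_def by force
  show ?thesis
  proof (rule LIMSEQ_I)
    fix r :: real assume "0 < r"
    define C where "C = 2 * real N * real k + 1"
    define \<epsilon> where "\<epsilon> = r / (2 * C)"
    have pos: "0 < C" by (simp add: C_def add_nonneg_pos)
    have \<epsilon>: "0 < \<epsilon>" "2 * real N * real k * \<epsilon> < r"
    proof -
      show "0 < \<epsilon>" using \<open>0 < r\<close> pos by (simp add: \<epsilon>_def)
      then have "2 * real N * real k * \<epsilon> \<le> C * \<epsilon>" by (simp add: C_def)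
      also have "\<dots> = r / 2" unfolding \<epsilon>_def using pos by simp
      finally show "2 * real N * real k * \<epsilon> < r" using \<open>0 < r\<close> by simp
    qed
    have "\<forall>\<^sub>F L in sequentially. \<forall>j\<in>{1..N}. \<forall>t\<in>{0..1}. \<bar>b j (grid_floor L t) - b j t\<bar> \<le> \<epsilon>"
    proof (rule eventually_ball_finite)
      show "\<forall>j\<in>{1..N}. \<forall>\<^sub>F L in sequentially. \<forall>t\<in>{0..1}. \<bar>b j (grid_floor L t) - b j t\<bar> \<le> \<epsilon>"
      proof
        fix j assume j: "j \<in> {1..N}"
        have "uniformly_continuous_on {0..1} (b j)"
          by (rule compact_uniformly_continuous[OF b[OF j] compact_Icc])
        then obtain d where d: "d > 0"
          "\<And>t t'. t \<in> {0..1} \<Longrightarrow> t' \<in> {0..1} \<Longrightarrow> dist t' t < d \<Longrightarrow> dist (b j t') (b j t) < \<epsilon>"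
          using \<epsilon>(1) unfolding uniformly_continuous_on_def by metis
        have "\<forall>\<^sub>F L in sequentially. 1 / real L < d"
          by (rule order_tendstoD(2)[OF lim_1_over_n d(1)])
        then show "\<forall>\<^sub>F L in sequentially. \<forall>t\<in>{0..1}. \<bar>b j (grid_floor L t) - b j t\<bar> \<le> \<epsilon>"
          using eventually_ge_at_top[of 1]
        proof eventually_elim
          case (elim L)
          show ?case
          proof
            fix t :: real assume t: "t \<in> {0..1}"
            have "dist (grid_floor L t) t < d"
              using grid_floor_dist[OF elim(2) t] elim(1) by (simp add: dist_real_def abs_minus_commute)
            from d(2)[OF t grid_floor_range[OF t] this]
            show "\<bar>b j (grid_floor L t) - b j t\<bar> \<le> \<epsilon>" by (simp add: dist_real_def)
          qed
        qed
      qed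
    qed simp
    then have "\<forall>\<^sub>F L in sequentially. norm (Omega k N (\<lambda>j t. b j (grid_floor L t)) - Omega k N b) < r"
    proof eventually_elim
      case (elim L)
      have "\<bar>Omega k N (\<lambda>j t. b j (grid_floor L t)) - Omega k N b\<bar> \<le> 2 * real N * real k * \<epsilon>"
        using elim by (intro Omega_abs_diff_le[OF \<open>k \<le> N\<close>, where K=K' and K'=K'] K' grid_floor_range) auto
      then show ?case using \<epsilon>(2) by simp
    qed
    then show "\<exists>no. \<forall>n\<ge>no. norm (Omega k N (\<lambda>j t. b j (grid_floor n t)) - Omega k N b) < r"
      by (simp add: eventually_sequentially)
  qed
qed

section \<open>Weak convergence of independent coordinates\<close>

text \<open>Because of independence, Skorohod's representation for real-valued variables is enough: it is applied to
  each coordinate separately, and the representations are put together on the product space.\<close>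

lemma indep_weak_conv_integral:
  fixes I :: "'i set" and V :: "nat \<Rightarrow> 'i \<Rightarrow> 'a \<Rightarrow> real" and U :: "'i \<Rightarrow> 'b \<Rightarrow> real"
    and h :: "('i \<Rightarrow> real) \<Rightarrow> complex"
  assumes I: "finite I" "I \<noteq> {}"
    and P: "prob_space P" and Q: "prob_space Q"
    and V: "\<And>n. prob_space.indep_vars P (\<lambda>_. borel) (V n) I"
    and U: "prob_space.indep_vars Q (\<lambda>_. borel) U I"
    and conv: "\<And>i. i \<in> I \<Longrightarrow> weak_conv_m (\<lambda>n. distr P borel (V n i)) (distr Q borel (U i))"
    and h: "h \<in> borel_measurable (PiM I (\<lambda>_. borel))"
    and h_bound: "\<And>v. norm (h v) \<le> C"
    and h_cont: "\<And>v u. (\<And>i. i \<in> I \<Longrightarrow> (\<lambda>n. v n i) \<longlonglongrightarrow> u i) \<Longrightarrow> (\<lambda>n. h (v n)) \<longlonglongrightarrow> h u"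
  shows "(\<lambda>n. \<integral>\<omega>. h (\<lambda>i\<in>I. V n i \<omega>) \<partial>P) \<longlonglongrightarrow> (\<integral>\<omega>. h (\<lambda>i\<in>I. U i \<omega>) \<partial>Q)"
proof -
  interpret P: prob_space P by (rule P)
  interpret Q: prob_space Q by (rule Q)
  have V_rv: "V n i \<in> borel_measurable P" if "i \<in> I" for n i
    using V[of n] that unfolding P.indep_vars_def by blast
  have U_rv: "U i \<in> borel_measurable Q" if "i \<in> I" for i
    using U that unfolding Q.indep_vars_def by blast
  define skorohod where "skorohod i W \<longleftrightarrow> (case W of (\<Omega>, Y_seq, Y) \<Rightarrow>
    prob_space \<Omega> \<and> (\<forall>n. Y_seq n \<in> borel_measurable \<Omega>) \<and>
    (\<forall>n. distr \<Omega> borel (Y_seq n) = distr P borel (V n i)) \<and>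
    Y \<in> borel_measurable \<Omega> \<and> distr \<Omega> borel Y = distr Q borel (U i) \<and>
    (\<forall>x\<in>space \<Omega>. (\<lambda>n. Y_seq n x) \<longlonglongrightarrow> Y x))"
    for i and W :: "real measure \<times> (nat \<Rightarrow> real \<Rightarrow> real) \<times> (real \<Rightarrow> real)"
  have "\<exists>W. skorohod i W" if i: "i \<in> I" for i
  proof -
    have "real_distribution (distr P borel (V n i))" for n by (rule P.real_distribution_distr[OF V_rv[OF i]])
    moreover have "real_distribution (distr Q borel (U i))" by (rule Q.real_distribution_distr[OF U_rv[OF i]])
    ultimately have "\<exists>(\<Omega> :: real measure) (Y_seq :: nat \<Rightarrow> real \<Rightarrow> real) (Y :: real \<Rightarrow> real).
        prob_space \<Omega> \<and> (\<forall>n. Y_seq n \<in> borel_measurable \<Omega>) \<and>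
        (\<forall>n. distr \<Omega> borel (Y_seq n) = distr P borel (V n i)) \<and>
        Y \<in> borel_measurable \<Omega> \<and> distr \<Omega> borel Y = distr Q borel (U i) \<and>
        (\<forall>x\<in>space \<Omega>. (\<lambda>n. Y_seq n x) \<longlonglongrightarrow> Y x)"
      by (rule Skorohod[OF _ _ conv[OF i], unfolded measurable_lborel1])
    then obtain \<Omega> :: "real measure" and Y :: "nat \<Rightarrow> real \<Rightarrow> real" and Z :: "real \<Rightarrow> real"
      where "prob_space \<Omega> \<and> (\<forall>n. Y n \<in> borel_measurable \<Omega>) \<and>
        (\<forall>n. distr \<Omega> borel (Y n) = distr P borel (V n i)) \<and>
        Z \<in> borel_measurable \<Omega> \<and> distr \<Omega> borel Z = distr Q borel (U i) \<and>
        (\<forall>x\<in>space \<Omega>. (\<lambda>n. Y n x) \<longlonglongrightarrow> Z x)"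
      by (elim exE) (rule that)
    then have "skorohod i (\<Omega>, Y, Z)" unfolding skorohod_def by simp
    then show ?thesis by blast
  qed
  then obtain W where W: "\<And>i. i \<in> I \<Longrightarrow> skorohod i (W i)" by metis
  define \<Omega> where "\<Omega> i = fst (W i)" for i
  define Y where "Y i = fst (snd (W i))" for i
  define Z where "Z i = snd (snd (W i))" for i
  have sk: "skorohod i (\<Omega> i, Y i, Z i)" if "i \<in> I" for i
    using W[OF that] by (simp add: \<Omega>_def Y_def Z_def)
  have \<Omega>': "prob_space (\<Omega> i)" and Y': "Y i n \<in> borel_measurable (\<Omega> i)"
    and dY: "distr (\<Omega> i) borel (Y i n) = distr P borel (V n i)"
    and Z': "Z i \<in> borel_measurable (\<Omega> i)"
    and dZ: "distr (\<Omega> i) borel (Z i) = distr Q borel (U i)"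
    and YZ: "x \<in> space (\<Omega> i) \<Longrightarrow> (\<lambda>n. Y i n x) \<longlonglongrightarrow> Z i x" if "i \<in> I" for i n x
    using sk[OF that] by (auto simp: skorohod_def)
  interpret R: prob_space "PiM I \<Omega>"
    by (rule prob_space_PiM) (rule \<Omega>')
  have coord: "R.indep_vars \<Omega> (\<lambda>i \<omega>. \<omega> i) I"
  proof -
    have "distr (PiM I \<Omega>) (PiM I \<Omega>) (\<lambda>x. \<lambda>i\<in>I. x i) = distr (PiM I \<Omega>) (PiM I \<Omega>) (\<lambda>x. x)"
      by (rule distr_cong) (auto simp: space_PiM)
    also have "\<dots> = PiM I \<Omega>" by (rule distr_id)
    also have "\<dots> = PiM I (\<lambda>i. distr (PiM I \<Omega>) (\<Omega> i) (\<lambda>x. x i))"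
      by (intro PiM_cong refl distr_PiM_component[OF \<Omega>', symmetric])
    finally show ?thesis
      by (subst R.indep_vars_iff_distr_eq_PiM'[OF I(2)]) (rule measurable_component_singleton)
  qed
  have law: "distr (PiM I \<Omega>) (PiM I (\<lambda>_. borel)) (\<lambda>\<omega>. \<lambda>i\<in>I. f i (\<omega> i)) = PiM I (\<lambda>i. distr (\<Omega> i) borel (f i))"
    if f: "\<And>i. i \<in> I \<Longrightarrow> f i \<in> borel_measurable (\<Omega> i)" for f :: "'i \<Rightarrow> real \<Rightarrow> real"
  proof -
    have rv: "(\<lambda>\<omega>. f i (\<omega> i)) \<in> borel_measurable (PiM I \<Omega>)" if "i \<in> I" for i
      using measurable_component_singleton[OF that, of \<Omega>] f[OF that] by (rule measurable_compose)
    have "R.indep_vars (\<lambda>_. borel) (\<lambda>i \<omega>. f i (\<omega> i)) I"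
      by (rule R.indep_vars_compose2[OF coord f])
    then have "distr (PiM I \<Omega>) (PiM I (\<lambda>_. borel)) (\<lambda>\<omega>. \<lambda>i\<in>I. f i (\<omega> i))
      = PiM I (\<lambda>i. distr (PiM I \<Omega>) borel (\<lambda>\<omega>. f i (\<omega> i)))"
      using R.indep_vars_iff_distr_eq_PiM'[OF I(2), where M'="\<lambda>_. borel" and X="\<lambda>i \<omega>. f i (\<omega> i)"] rv by blast
    also have "\<dots> = PiM I (\<lambda>i. distr (\<Omega> i) borel (f i))"
    proof (rule PiM_cong[OF refl])
      fix i assume i: "i \<in> I"
      have "distr (PiM I \<Omega>) borel (\<lambda>\<omega>. f i (\<omega> i)) = distr (distr (PiM I \<Omega>) (\<Omega> i) (\<lambda>\<omega>. \<omega> i)) borel (f i)"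
        by (subst distr_distr[OF f[OF i] measurable_component_singleton[OF i, of \<Omega>]]) (simp add: comp_def)
      also have "distr (PiM I \<Omega>) (\<Omega> i) (\<lambda>\<omega>. \<omega> i) = \<Omega> i"
        by (rule distr_PiM_component[OF \<Omega>' i])
      finally show "distr (PiM I \<Omega>) borel (\<lambda>\<omega>. f i (\<omega> i)) = distr (\<Omega> i) borel (f i)" .
    qed
    finally show ?thesis .
  qed
  have meas: "(\<lambda>\<omega>. \<lambda>i\<in>I. f i (\<omega> i)) \<in> measurable (PiM I \<Omega>) (PiM I (\<lambda>_. borel))"
    if f: "\<And>i. i \<in> I \<Longrightarrow> f i \<in> borel_measurable (\<Omega> i)" for f :: "'i \<Rightarrow> real \<Rightarrow> real"
  proof (rule measurable_restrict)
    fix i assume i: "i \<in> I"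
    show "(\<lambda>\<omega>. f i (\<omega> i)) \<in> borel_measurable (PiM I \<Omega>)"
      using measurable_component_singleton[OF i, of \<Omega>] f[OF i] by (rule measurable_compose)
  qed
  have eqV: "(\<integral>\<omega>. h (\<lambda>i\<in>I. V n i \<omega>) \<partial>P) = (\<integral>\<omega>. h (\<lambda>i\<in>I. Y i n (\<omega> i)) \<partial>PiM I \<Omega>)" for n
  proof -
    have "(\<integral>\<omega>. h (\<lambda>i\<in>I. V n i \<omega>) \<partial>P) = (\<integral>v. h v \<partial>distr P (PiM I (\<lambda>_. borel)) (\<lambda>\<omega>. \<lambda>i\<in>I. V n i \<omega>))"
      by (subst integral_distr[OF measurable_restrict h]) (auto intro: V_rv)
    also have "distr P (PiM I (\<lambda>_. borel)) (\<lambda>\<omega>. \<lambda>i\<in>I. V n i \<omega>) = PiM I (\<lambda>i. distr P borel (V n i))"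
      using V[of n] P.indep_vars_iff_distr_eq_PiM'[OF I(2), where M'="\<lambda>_. borel" and X="V n"] V_rv by blast
    also have "\<dots> = PiM I (\<lambda>i. distr (\<Omega> i) borel (Y i n))"
      by (intro PiM_cong refl) (simp add: dY)
    also have "\<dots> = distr (PiM I \<Omega>) (PiM I (\<lambda>_. borel)) (\<lambda>\<omega>. \<lambda>i\<in>I. Y i n (\<omega> i))"
      by (rule law[OF Y', symmetric])
    also have "(\<integral>v. h v \<partial>distr (PiM I \<Omega>) (PiM I (\<lambda>_. borel)) (\<lambda>\<omega>. \<lambda>i\<in>I. Y i n (\<omega> i)))
      = (\<integral>\<omega>. h (\<lambda>i\<in>I. Y i n (\<omega> i)) \<partial>PiM I \<Omega>)"
      by (rule integral_distr[OF meas[OF Y'] h])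
    finally show ?thesis .
  qed
  have eqU: "(\<integral>\<omega>. h (\<lambda>i\<in>I. U i \<omega>) \<partial>Q) = (\<integral>\<omega>. h (\<lambda>i\<in>I. Z i (\<omega> i)) \<partial>PiM I \<Omega>)"
  proof -
    have "(\<integral>\<omega>. h (\<lambda>i\<in>I. U i \<omega>) \<partial>Q) = (\<integral>v. h v \<partial>distr Q (PiM I (\<lambda>_. borel)) (\<lambda>\<omega>. \<lambda>i\<in>I. U i \<omega>))"
      by (subst integral_distr[OF measurable_restrict h]) (auto intro: U_rv)
    also have "distr Q (PiM I (\<lambda>_. borel)) (\<lambda>\<omega>. \<lambda>i\<in>I. U i \<omega>) = PiM I (\<lambda>i. distr Q borel (U i))"
      using Q.indep_vars_iff_distr_eq_PiM'[OF I(2), where M'="\<lambda>_. borel" and X=U] U U_rv by blast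
    also have "\<dots> = PiM I (\<lambda>i. distr (\<Omega> i) borel (Z i))"
      by (intro PiM_cong refl) (simp add: dZ)
    also have "\<dots> = distr (PiM I \<Omega>) (PiM I (\<lambda>_. borel)) (\<lambda>\<omega>. \<lambda>i\<in>I. Z i (\<omega> i))"
      by (rule law[OF Z', symmetric])
    also have "(\<integral>v. h v \<partial>distr (PiM I \<Omega>) (PiM I (\<lambda>_. borel)) (\<lambda>\<omega>. \<lambda>i\<in>I. Z i (\<omega> i)))
      = (\<integral>\<omega>. h (\<lambda>i\<in>I. Z i (\<omega> i)) \<partial>PiM I \<Omega>)"
      by (rule integral_distr[OF meas[OF Z'] h])
    finally show ?thesis .
  qed
  show ?thesis
    unfolding eqV eqU
  proof (rule integral_dominated_convergence[where w="\<lambda>_. C"])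
    show "(\<lambda>\<omega>. h (\<lambda>i\<in>I. Z i (\<omega> i))) \<in> borel_measurable (PiM I \<Omega>)"
      by (rule measurable_compose[OF meas[OF Z'] h])
    show "(\<lambda>\<omega>. h (\<lambda>i\<in>I. Y i n (\<omega> i))) \<in> borel_measurable (PiM I \<Omega>)" for n
      by (rule measurable_compose[OF meas[OF Y'] h])
    show "AE \<omega> in PiM I \<Omega>. (\<lambda>n. h (\<lambda>i\<in>I. Y i n (\<omega> i))) \<longlonglongrightarrow> h (\<lambda>i\<in>I. Z i (\<omega> i))"
    proof (rule AE_I2)
      fix \<omega> assume "\<omega> \<in> space (PiM I \<Omega>)"
      then have "\<omega> i \<in> space (\<Omega> i)" if "i \<in> I" for i using that by (auto simp: space_PiM)
      then show "(\<lambda>n. h (\<lambda>i\<in>I. Y i n (\<omega> i))) \<longlonglongrightarrow> h (\<lambda>i\<in>I. Z i (\<omega> i))"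
        by (intro h_cont) (simp add: YZ)
    qed
  qed (auto simp: h_bound)
qed

text \<open>With Skorohod's representation the convergence is pointwise, so that the index \<open>r n\<close> and the factor
  \<open>c n\<close> may vary at the same time.\<close>

lemma weak_conv_m_rescale:
  fixes c :: "nat \<Rightarrow> real"
  assumes P: "prob_space P" and S: "\<And>n. S n \<in> borel_measurable P"
    and \<mu>: "real_distribution \<mu>"
    and conv: "weak_conv_m (\<lambda>n. distr P borel (S n)) \<mu>"
    and r: "filterlim r at_top sequentially" and c: "c \<longlonglongrightarrow> a"
  shows "weak_conv_m (\<lambda>n. distr P borel (\<lambda>\<omega>. c n * S (r n) \<omega>)) (distr \<mu> borel (\<lambda>x. a * x))"
proof -
  interpret P: prob_space P by (rule P)
  interpret \<mu>: real_distribution \<mu> by (rule \<mu>)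
  have rd: "real_distribution (distr P borel (S n))" for n
    by (rule P.real_distribution_distr[OF S])
  obtain \<Omega> :: "real measure" and Y :: "nat \<Rightarrow> real \<Rightarrow> real" and Z :: "real \<Rightarrow> real"
    where sk: "prob_space \<Omega> \<and> (\<forall>n. Y n \<in> borel_measurable \<Omega>) \<and>
      (\<forall>n. distr \<Omega> borel (Y n) = distr P borel (S n)) \<and>
      Z \<in> borel_measurable \<Omega> \<and> distr \<Omega> borel Z = \<mu> \<and>
      (\<forall>x\<in>space \<Omega>. (\<lambda>n. Y n x) \<longlonglongrightarrow> Z x)"
    using Skorohod[OF rd \<mu> conv, unfolded measurable_lborel1] by (elim exE) (rule that)
  then have \<Omega>: "prob_space \<Omega>" and Y: "\<And>n. Y n \<in> borel_measurable \<Omega>"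
    and dY: "\<And>n. distr \<Omega> borel (Y n) = distr P borel (S n)"
    and Z: "Z \<in> borel_measurable \<Omega>" and dZ: "distr \<Omega> borel Z = \<mu>"
    and YZ: "\<And>x. x \<in> space \<Omega> \<Longrightarrow> (\<lambda>n. Y n x) \<longlonglongrightarrow> Z x"
    by blast+
  interpret \<Omega>: prob_space \<Omega> by (rule \<Omega>)
  show ?thesis
  proof (rule levy_continuity)
    show "real_distribution (distr P borel (\<lambda>\<omega>. c n * S (r n) \<omega>))" for n
      using S by (intro P.real_distribution_distr) simp
    show "real_distribution (distr \<mu> borel (\<lambda>x. a * x))"
      by (intro \<mu>.real_distribution_distr) simp
    fix t
    have 1: "char (distr P borel (\<lambda>\<omega>. c n * S (r n) \<omega>)) t = (CLINT \<omega>|\<Omega>. iexp (t * (c n * Y (r n) \<omega>)))" for n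
    proof -
      have "char (distr P borel (\<lambda>\<omega>. c n * S (r n) \<omega>)) t = (CLINT x|distr P borel (S (r n)). iexp (t * (c n * x)))"
        unfolding char_def using S by (simp add: integral_distr)
      also have "\<dots> = (CLINT \<omega>|\<Omega>. iexp (t * (c n * Y (r n) \<omega>)))"
        unfolding dY[symmetric] using Y by (simp add: integral_distr)
      finally show ?thesis .
    qed
    have 2: "char (distr \<mu> borel (\<lambda>x. a * x)) t = (CLINT \<omega>|\<Omega>. iexp (t * (a * Z \<omega>)))"
      unfolding char_def dZ[symmetric] using Z by (simp add: integral_distr)
    show "(\<lambda>n. char (distr P borel (\<lambda>\<omega>. c n * S (r n) \<omega>)) t) \<longlonglongrightarrow> char (distr \<mu> borel (\<lambda>x. a * x)) t"
      unfolding 1 2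
    proof (rule integral_dominated_convergence[where w="\<lambda>_. 1"])
      show "AE x in \<Omega>. (\<lambda>n. iexp (t * (c n * Y (r n) x))) \<longlonglongrightarrow> iexp (t * (a * Z x))"
      proof (rule AE_I2)
        fix x assume "x \<in> space \<Omega>"
        then have "(\<lambda>n. Y (r n) x) \<longlonglongrightarrow> Z x"
          using filterlim_compose[OF YZ r] by blast
        then show "(\<lambda>n. iexp (t * (c n * Y (r n) x))) \<longlonglongrightarrow> iexp (t * (a * Z x))"
          using c by (intro tendsto_intros)
      qed
    qed (use Y Z in auto)
  qed
qed

section \<open>Oscillations of exponential random walks\<close>

text \<open>Split according to the first time \<open>n\<close> at which the partial sum reaches \<open>2 * c\<close>. Independently of this
  event, the remaining sum stays below \<open>c\<close> with probability at least one half, and then the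
  final sum exceeds \<open>c\<close>.\<close>

lemma (in prob_space) ottaviani:
  fixes X :: "nat \<Rightarrow> 'a \<Rightarrow> real" and a b :: nat and c :: real
  defines "S \<equiv> \<lambda>n \<omega>. \<Sum>i\<in>{a<..n}. X i \<omega>"
  assumes indep: "indep_vars (\<lambda>_. borel) X {a<..b}"
    and tail: "\<And>n. n \<in> {a..b} \<Longrightarrow> prob {\<omega>\<in>space M. c \<le> \<bar>\<Sum>i\<in>{n<..b}. X i \<omega>\<bar>} \<le> 1 / 2"
  shows "prob {\<omega>\<in>space M. \<exists>n\<in>{a..b}. 2 * c \<le> \<bar>S n \<omega>\<bar>} \<le> 2 * prob {\<omega>\<in>space M. c \<le> \<bar>S b \<omega>\<bar>}"
proof -
  have X [measurable]: "X i \<in> borel_measurable M" if "i \<in> {a<..b}" for i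
    using indep that unfolding indep_vars_def by blast
  have S [measurable]: "S n \<in> borel_measurable M" if "n \<in> {a..b}" for n
    unfolding S_def using that by (intro borel_measurable_sum X) auto
  have R [measurable]: "(\<lambda>\<omega>. \<Sum>i\<in>{n<..b}. X i \<omega>) \<in> borel_measurable M" if "n \<in> {a..b}" for n
    using that by (intro borel_measurable_sum X) auto
  define A where "A n = {\<omega>\<in>space M. 2 * c \<le> \<bar>S n \<omega>\<bar> \<and> (\<forall>m\<in>{a..<n}. \<bar>S m \<omega>\<bar> < 2 * c)}" for n
  define B where "B n = {\<omega>\<in>space M. \<bar>\<Sum>i\<in>{n<..b}. X i \<omega>\<bar> < c}" for n
  have A_ev: "A n \<in> events" if "n \<in> {a..b}" for n
  proof -
    have S': "S m \<in> borel_measurable M" if "m \<in> {a..<n}" for m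
      using that \<open>n \<in> {a..b}\<close> by (intro S) auto
    have "{\<omega>\<in>space M. 2 * c \<le> \<bar>S n \<omega>\<bar>} \<in> events" using S[OF that] by measurable
    moreover have "{\<omega>\<in>space M. \<forall>m\<in>{a..<n}. \<bar>S m \<omega>\<bar> < 2 * c} \<in> events"
    proof (rule sets.sets_Collect_finite_All)
      fix m assume "m \<in> {a..<n}"
      from S'[OF this] show "{\<omega>\<in>space M. \<bar>S m \<omega>\<bar> < 2 * c} \<in> events" by measurable
    qed simp
    ultimately have "{\<omega>\<in>space M. 2 * c \<le> \<bar>S n \<omega>\<bar>} \<inter> {\<omega>\<in>space M. \<forall>m\<in>{a..<n}. \<bar>S m \<omega>\<bar> < 2 * c} \<in> events"
      by (rule sets.Int)
    also have "{\<omega>\<in>space M. 2 * c \<le> \<bar>S n \<omega>\<bar>} \<inter> {\<omega>\<in>space M. \<forall>m\<in>{a..<n}. \<bar>S m \<omega>\<bar> < 2 * c} = A n"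
      by (auto simp: A_def)
    finally show ?thesis .
  qed
  have B_ev: "B n \<in> events" if "n \<in> {a..b}" for n
    unfolding B_def using R[OF that] by measurable
  have disj: "A m \<inter> A n = {}" if "m \<in> {a..b}" "n \<in> {a..b}" "m < n" for m n
    using that by (force simp: A_def)
  then have disj': "disjoint_family_on A {a..b}"
    unfolding disjoint_family_on_def by (metis Int_commute linorder_neqE_nat)
  have union: "{\<omega>\<in>space M. \<exists>n\<in>{a..b}. 2 * c \<le> \<bar>S n \<omega>\<bar>} = (\<Union>n\<in>{a..b}. A n)"
  proof (intro equalityI subsetI)
    fix \<omega> assume \<omega>: "\<omega> \<in> {\<omega>\<in>space M. \<exists>n\<in>{a..b}. 2 * c \<le> \<bar>S n \<omega>\<bar>}"
    define n where "n = (LEAST n. n \<in> {a..b} \<and> 2 * c \<le> \<bar>S n \<omega>\<bar>)"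
    have n: "n \<in> {a..b} \<and> 2 * c \<le> \<bar>S n \<omega>\<bar>"
      unfolding n_def by (rule LeastI_ex) (use \<omega> in blast)
    have "\<bar>S m \<omega>\<bar> < 2 * c" if "m \<in> {a..<n}" for m
    proof (rule ccontr)
      assume "\<not> \<bar>S m \<omega>\<bar> < 2 * c"
      then have "n \<le> m" unfolding n_def using that n by (intro Least_le) auto
      then show False using that by simp
    qed
    then show "\<omega> \<in> (\<Union>n\<in>{a..b}. A n)" using n \<omega> by (auto simp: A_def)
  qed (auto simp: A_def)
  have AB: "prob (A n) \<le> 2 * prob (A n \<inter> B n)" if n: "n \<in> {a..b}" for n
  proof -
    let ?f = "\<lambda>m f. \<Sum>i\<in>{a<..m}. f i"
    define EA where "EA = {f\<in>space (PiM {a<..n} (\<lambda>_. borel)). 2 * c \<le> \<bar>?f n f\<bar> \<and> (\<forall>m\<in>{a..<n}. \<bar>?f m f\<bar> < 2 * c)}"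
    define EB where "EB = {f\<in>space (PiM {n<..b} (\<lambda>_. borel)). \<bar>\<Sum>i\<in>{n<..b}. f i\<bar> < c}"
    have fm: "?f m \<in> borel_measurable (PiM {a<..n} (\<lambda>_. borel :: real measure))" if "m \<le> n" for m
      using that by (intro borel_measurable_sum measurable_component_singleton) auto
    have EA: "EA \<in> sets (PiM {a<..n} (\<lambda>_. borel))"
    proof -
      let ?N = "PiM {a<..n} (\<lambda>_. borel :: real measure)"
      have "{f\<in>space ?N. 2 * c \<le> \<bar>?f n f\<bar>} \<in> sets ?N" using fm[OF order_refl] by measurable
      moreover have "{f\<in>space ?N. \<forall>m\<in>{a..<n}. \<bar>?f m f\<bar> < 2 * c} \<in> sets ?N"
      proof (rule sets.sets_Collect_finite_All)
        fix m assume "m \<in> {a..<n}"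
        then have "?f m \<in> borel_measurable ?N" by (intro fm) simp
        then show "{f\<in>space ?N. \<bar>?f m f\<bar> < 2 * c} \<in> sets ?N" by measurable
      qed simp
      ultimately have "{f\<in>space ?N. 2 * c \<le> \<bar>?f n f\<bar>} \<inter> {f\<in>space ?N. \<forall>m\<in>{a..<n}. \<bar>?f m f\<bar> < 2 * c} \<in> sets ?N"
        by (rule sets.Int)
      also have "{f\<in>space ?N. 2 * c \<le> \<bar>?f n f\<bar>} \<inter> {f\<in>space ?N. \<forall>m\<in>{a..<n}. \<bar>?f m f\<bar> < 2 * c} = EA"
        by (auto simp: EA_def)
      finally show ?thesis .
    qed
    have EB: "EB \<in> sets (PiM {n<..b} (\<lambda>_. borel))"
    proof -
      have "(\<lambda>f. \<Sum>i\<in>{n<..b}. f i) \<in> borel_measurable (PiM {n<..b} (\<lambda>_. borel :: real measure))"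
        by (intro borel_measurable_sum measurable_component_singleton)
      then show ?thesis unfolding EB_def by measurable
    qed
    let ?XA = "\<lambda>\<omega>. restrict (\<lambda>i. X i \<omega>) {a<..n}" and ?XB = "\<lambda>\<omega>. restrict (\<lambda>i. X i \<omega>) {n<..b}"
    have A: "A n = ?XA -` EA \<inter> space M"
    proof -
      have "?f m (?XA \<omega>) = S m \<omega>" if "m \<le> n" for m \<omega>
        unfolding S_def using that by (intro sum.cong) auto
      then show ?thesis by (auto simp: A_def EA_def space_PiM)
    qed
    have B: "B n = ?XB -` EB \<inter> space M"
    proof -
      have "(\<Sum>i\<in>{n<..b}. ?XB \<omega> i) = (\<Sum>i\<in>{n<..b}. X i \<omega>)" for \<omega>
        by (intro sum.cong) auto
      then show ?thesis by (auto simp: B_def EB_def space_PiM)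
    qed
    have "indep_var (PiM {a<..n} (\<lambda>_. borel)) ?XA (PiM {n<..b} (\<lambda>_. borel)) ?XB"
      using n by (intro indep_var_restrict[OF indep]) auto
    from indep_varD[OF this EA EB]
    have "prob (A n \<inter> B n) = prob (A n) * prob (B n)"
      unfolding A B by (simp add: vimage_def Int_def conj_commute conj_left_commute)
    moreover have "prob (B n) \<ge> 1 / 2"
    proof -
      have "B n = space M - {\<omega>\<in>space M. c \<le> \<bar>\<Sum>i\<in>{n<..b}. X i \<omega>\<bar>}" by (auto simp: B_def)
      moreover have "{\<omega>\<in>space M. c \<le> \<bar>\<Sum>i\<in>{n<..b}. X i \<omega>\<bar>} \<in> events" using R[OF n] by measurable
      ultimately show ?thesis using tail[OF n] by (simp add: prob_compl)
    qed
    ultimately show ?thesis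
      using mult_left_mono[of "1 / 2" "prob (B n)" "prob (A n)"] by simp
  qed
  have "prob (\<Union>n\<in>{a..b}. A n) = (\<Sum>n\<in>{a..b}. prob (A n))"
    using A_ev disj' by (intro finite_measure_finite_Union) auto
  also have "\<dots> \<le> (\<Sum>n\<in>{a..b}. 2 * prob (A n \<inter> B n))" by (intro sum_mono AB)
  also have "\<dots> = 2 * prob (\<Union>n\<in>{a..b}. A n \<inter> B n)"
  proof -
    have "disjoint_family_on (\<lambda>n. A n \<inter> B n) {a..b}"
      using disj' unfolding disjoint_family_on_def by blast
    then have "prob (\<Union>n\<in>{a..b}. A n \<inter> B n) = (\<Sum>n\<in>{a..b}. prob (A n \<inter> B n))"
      using A_ev B_ev by (intro finite_measure_finite_Union) auto
    then show ?thesis by (simp add: sum_distrib_left)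
  qed
  also have "prob (\<Union>n\<in>{a..b}. A n \<inter> B n) \<le> prob {\<omega>\<in>space M. c \<le> \<bar>S b \<omega>\<bar>}"
  proof (cases "a \<le> b")
    case True
    show ?thesis
    proof (rule finite_measure_mono)
      show "(\<Union>n\<in>{a..b}. A n \<inter> B n) \<subseteq> {\<omega>\<in>space M. c \<le> \<bar>S b \<omega>\<bar>}"
      proof
        fix \<omega> assume "\<omega> \<in> (\<Union>n\<in>{a..b}. A n \<inter> B n)"
        then obtain n where n: "n \<in> {a..b}" "\<omega> \<in> A n" "\<omega> \<in> B n" by blast
        have "{a<..b} = {a<..n} \<union> {n<..b}" using n(1) by auto
        then have "S b \<omega> = S n \<omega> + (\<Sum>i\<in>{n<..b}. X i \<omega>)"
          unfolding S_def by (simp only:) (intro sum.union_disjoint; auto)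
        then show "\<omega> \<in> {\<omega>\<in>space M. c \<le> \<bar>S b \<omega>\<bar>}" using n(2,3) by (auto simp: A_def B_def)
      qed
      have "S b \<in> borel_measurable M" using True by (intro S) simp
      then show "{\<omega>\<in>space M. c \<le> \<bar>S b \<omega>\<bar>} \<in> events" by measurable
    qed
  qed simp
  finally show ?thesis unfolding union by simp
qed

text \<open>A sum of \<open>n\<close> independent exponential variables has an Erlang law, whose moments are rising
  factorials; the fourth central moment is \<open>3 * n\<^sup>2 + 6 * n\<close>. Second moments would not suffice:
  below, the bound for one of \<open>L\<close> blocks must be small compared with \<open>1 / L\<close>.\<close>

lemma (in prob_space) exponential_sum_fourth_moment:
  fixes X :: "'i \<Rightarrow> 'a \<Rightarrow> real"
  assumes I: "finite I" "I \<noteq> {}"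
    and X: "\<And>i. i \<in> I \<Longrightarrow> distributed M lborel (X i) (exponential_density 1)"
    and indep: "indep_vars (\<lambda>_. borel) X I"
  defines "Y \<equiv> \<lambda>\<omega>. (\<Sum>i\<in>I. X i \<omega> - 1) ^ 4"
  shows "integrable M Y" "expectation Y \<le> 9 * (real (card I))\<^sup>2"
proof -
  define T where "T \<omega> = (\<Sum>i\<in>I. X i \<omega>)" for \<omega>
  obtain m where m: "card I = Suc m" using I by (metis card_gt_0_iff gr0_implies_Suc)
  define n where "n = real (Suc m)"
  have D: "distributed M lborel T (erlang_density m 1)"
    using exponential_distributed_sum[OF I zero_less_one X indep] m by (simp add: T_def[abs_def])
  have int: "integrable M (\<lambda>\<omega>. T \<omega> ^ i)" for i
    by (rule erlang_ith_moment_integrable[OF zero_less_one D])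
  have ex: "expectation (\<lambda>\<omega>. T \<omega> ^ i) = fact (m + i) / fact m" for i
    using erlang_ith_moment[OF zero_less_one D, of i] by simp
  have e: "expectation (\<lambda>\<omega>. T \<omega> ^ 1) = n" "expectation (\<lambda>\<omega>. T \<omega> ^ 2) = n * (n + 1)"
    "expectation (\<lambda>\<omega>. T \<omega> ^ 3) = n * (n + 1) * (n + 2)"
    "expectation (\<lambda>\<omega>. T \<omega> ^ 4) = n * (n + 1) * (n + 2) * (n + 3)"
    unfolding ex n_def by (simp_all add: eval_nat_numeral field_simps)
  have Y: "Y = (\<lambda>\<omega>. T \<omega> ^ 4 - 4 * n * T \<omega> ^ 3 + 6 * n\<^sup>2 * T \<omega> ^ 2 - 4 * n ^ 3 * T \<omega> ^ 1 + n ^ 4)"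
  proof
    fix \<omega>
    have "Y \<omega> = (T \<omega> - n) ^ 4" using m by (simp add: Y_def T_def sum_subtractf n_def)
    then show "Y \<omega> = T \<omega> ^ 4 - 4 * n * T \<omega> ^ 3 + 6 * n\<^sup>2 * T \<omega> ^ 2 - 4 * n ^ 3 * T \<omega> ^ 1 + n ^ 4"
      by (simp add: power4_eq_xxxx power3_eq_cube power2_eq_square algebra_simps)
  qed
  show "integrable M Y"
    unfolding Y by (intro Bochner_Integration.integrable_add Bochner_Integration.integrable_diff integrable_mult_right int) simp
  have "expectation Y = expectation (\<lambda>\<omega>. T \<omega> ^ 4) - 4 * n * expectation (\<lambda>\<omega>. T \<omega> ^ 3)
      + 6 * n\<^sup>2 * expectation (\<lambda>\<omega>. T \<omega> ^ 2) - 4 * n ^ 3 * expectation (\<lambda>\<omega>. T \<omega> ^ 1) + n ^ 4"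
    unfolding Y using int[of 1] int[of 2] int[of 3] int[of 4] by (simp add: prob_space)
  also have "\<dots> = 3 * n\<^sup>2 + 6 * n"
    unfolding e by (simp add: power4_eq_xxxx power3_eq_cube power2_eq_square algebra_simps)
  also have "\<dots> \<le> 9 * n\<^sup>2"
  proof -
    have "n * 1 \<le> n * n" unfolding n_def by (intro mult_left_mono) auto
    then show ?thesis by (simp add: power2_eq_square)
  qed
  finally show "expectation Y \<le> 9 * (real (card I))\<^sup>2" by (simp add: n_def m)
qed

lemma (in prob_space) exponential_sum_tail:
  fixes X :: "'i \<Rightarrow> 'a \<Rightarrow> real"
  assumes I: "finite I" and c: "0 < c"
    and X: "\<And>i. i \<in> I \<Longrightarrow> distributed M lborel (X i) (exponential_density 1)"
    and indep: "indep_vars (\<lambda>_. borel) X I"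
  shows "prob {\<omega>\<in>space M. c \<le> \<bar>\<Sum>i\<in>I. X i \<omega> - 1\<bar>} \<le> 9 * (real (card I))\<^sup>2 / c ^ 4"
proof (cases "I = {}")
  case False
  let ?Y = "\<lambda>\<omega>. (\<Sum>i\<in>I. X i \<omega> - 1) ^ 4"
  note Y = exponential_sum_fourth_moment[OF I False X indep]
  have "{\<omega>\<in>space M. c \<le> \<bar>\<Sum>i\<in>I. X i \<omega> - 1\<bar>} = {\<omega>\<in>space M. c ^ 4 \<le> ?Y \<omega>}"
  proof -
    have "c \<le> \<bar>x\<bar> \<longleftrightarrow> c ^ 4 \<le> x ^ 4" for x :: real
      using power_mono_iff[of c "\<bar>x\<bar>" 4] c by (simp add: power_even_abs)
    then show ?thesis by simp
  qed
  also have "prob \<dots> \<le> expectation ?Y / c ^ 4"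
    using Y(1) c by (intro integral_Markov_inequality_measure[of _ _ "space M"]) auto
  also have "\<dots> \<le> 9 * (real (card I))\<^sup>2 / c ^ 4"
    using Y(2) by (intro divide_right_mono) auto
  finally show ?thesis .
qed (use c in simp)

text \<open>If the fourth-moment bound on the tails is at most one half, Ottaviani's inequality applies; otherwise
  the right-hand side exceeds 1.\<close>

lemma (in prob_space) exponential_walk_oscillation:
  fixes X :: "nat \<Rightarrow> 'a \<Rightarrow> real"
  assumes c: "0 < c"
    and X: "\<And>i. i \<in> {a<..b} \<Longrightarrow> distributed M lborel (X i) (exponential_density 1)"
    and indep: "indep_vars (\<lambda>_. borel) X {a<..b}"
  shows "prob {\<omega>\<in>space M. \<exists>n\<in>{a..b}. 2 * c \<le> \<bar>\<Sum>i\<in>{a<..n}. X i \<omega> - 1\<bar>}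
    \<le> 18 * (real (b - a))\<^sup>2 / c ^ 4"
proof (cases "9 * (real (b - a))\<^sup>2 / c ^ 4 \<le> 1 / 2")
  case True
  have tail: "prob {\<omega>\<in>space M. c \<le> \<bar>\<Sum>i\<in>{n<..b}. X i \<omega> - 1\<bar>} \<le> 9 * (real (b - a))\<^sup>2 / c ^ 4"
    if "n \<ge> a" for n
  proof -
    have "prob {\<omega>\<in>space M. c \<le> \<bar>\<Sum>i\<in>{n<..b}. X i \<omega> - 1\<bar>} \<le> 9 * (real (card {n<..b}))\<^sup>2 / c ^ 4"
      using that by (intro exponential_sum_tail c X indep_vars_subset[OF indep]) auto
    also have "\<dots> \<le> 9 * (real (b - a))\<^sup>2 / c ^ 4"
      using that c by (intro divide_right_mono mult_left_mono power_mono) auto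
    finally show ?thesis .
  qed
  have "indep_vars (\<lambda>_. borel) (\<lambda>i \<omega>. X i \<omega> - 1) {a<..b}"
    by (rule indep_vars_compose2[OF indep]) simp
  from ottaviani[OF this, of c]
  have "prob {\<omega>\<in>space M. \<exists>n\<in>{a..b}. 2 * c \<le> \<bar>\<Sum>i\<in>{a<..n}. X i \<omega> - 1\<bar>}
      \<le> 2 * prob {\<omega>\<in>space M. c \<le> \<bar>\<Sum>i\<in>{a<..b}. X i \<omega> - 1\<bar>}"
    using tail True by fastforce
  then show ?thesis using tail[OF order_refl] by linarith
next
  case False
  have "prob {\<omega>\<in>space M. \<exists>n\<in>{a..b}. 2 * c \<le> \<bar>\<Sum>i\<in>{a<..n}. X i \<omega> - 1\<bar>} \<le> 1" by simp
  then show ?thesis using False by linarith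
qed

section \<open>The central limit theorem for blocks\<close>

lemma (in prob_space) distr_exponential_sum_cong:
  fixes X :: "'i \<Rightarrow> 'a \<Rightarrow> real" and X' :: "'j \<Rightarrow> 'a \<Rightarrow> real"
  assumes "finite I" "finite J" "card I = card J"
    and X: "\<And>i. i \<in> I \<Longrightarrow> distributed M lborel (X i) (exponential_density 1)" "indep_vars (\<lambda>_. borel) X I"
    and X': "\<And>i. i \<in> J \<Longrightarrow> distributed M lborel (X' i) (exponential_density 1)" "indep_vars (\<lambda>_. borel) X' J"
  shows "distr M borel (\<lambda>\<omega>. \<Sum>i\<in>I. X i \<omega>) = distr M borel (\<lambda>\<omega>. \<Sum>i\<in>J. X' i \<omega>)"
proof (cases "I = {}")
  case True
  then show ?thesis using assms by simp
next
  case False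
  then have "J \<noteq> {}" using assms by auto
  have law: "distr M borel T = density lborel f" if "distributed M lborel T f" for T :: "'a \<Rightarrow> real" and f
  proof -
    have "distr M borel T = distr M lborel T" by (rule distr_cong) simp_all
    then show ?thesis using distributed_distr_eq_density[OF that] by simp
  qed
  show ?thesis
    using law[OF exponential_distributed_sum[OF assms(1) False zero_less_one X]]
      law[OF exponential_distributed_sum[OF assms(2) \<open>J \<noteq> {}\<close> zero_less_one X']] assms(3) by simp
qed

lemma (in prob_space) exponential_clt:
  fixes X :: "nat \<Rightarrow> 'a \<Rightarrow> real"
  assumes X: "\<And>i. distributed M lborel (X i) (exponential_density 1)"
    and indep: "indep_vars (\<lambda>_. borel) X UNIV"
  shows "weak_conv_m (\<lambda>n. distr M borel (\<lambda>\<omega>. (\<Sum>i<n. X i \<omega> - 1) / sqrt (real n))) std_normal_distribution"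
proof -
  have "weak_conv_m (\<lambda>n. distr M borel (\<lambda>\<omega>. (\<Sum>i<n. X i \<omega> - 1) / sqrt (real n * 1\<^sup>2))) std_normal_distribution"
  proof (rule central_limit_theorem)
    show "expectation (X n) = 1" for n
      using exponential_distributed_expectation[OF zero_less_one X] by simp
    show "variance (X n) = 1\<^sup>2" for n
      using exponential_distributed_variance[OF zero_less_one X] by simp
    show "integrable M (\<lambda>x. (X n x)\<^sup>2)" for n
      by (rule erlang_ith_moment_integrable[OF zero_less_one X])
    show "distr M borel (X n) = density lborel (exponential_density 1)" for n
    proof -
      have "distr M borel (X n) = distr M lborel (X n)" by (rule distr_cong) simp_all
      then show ?thesis using distributed_distr_eq_density[OF X[of n]] by simp
    qed
  qed (use indep in simp_all)
  then show ?thesis by simp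
qed

text \<open>The law of a block sum depends only on the length of the block, so the central limit theorem for one
  sequence of partial sums covers blocks whose position moves.\<close>

lemma (in prob_space) exponential_block_clt:
  fixes X :: "nat \<Rightarrow> 'a \<Rightarrow> real" and lo hi :: "nat \<Rightarrow> nat"
  assumes X: "\<And>i. 1 \<le> i \<Longrightarrow> distributed M lborel (X i) (exponential_density 1)"
    and indep: "indep_vars (\<lambda>_. borel) X {1..}"
    and r: "filterlim (\<lambda>n. hi n - lo n) at_top sequentially"
    and v: "(\<lambda>n. real (hi n - lo n) / real n) \<longlonglongrightarrow> v"
  shows "weak_conv_m (\<lambda>n. distr M borel (\<lambda>\<omega>. (\<Sum>i\<in>{lo n<..hi n}. X i \<omega> - 1) / sqrt (real n)))
    (distr std_normal_distribution borel (\<lambda>x. sqrt v * x))"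
proof -
  define S where "S n \<omega> = (\<Sum>i<n. X (Suc i) \<omega> - 1) / sqrt (real n)" for n \<omega>
  have Xm: "X i \<in> borel_measurable M" if "1 \<le> i" for i
    using distributed_measurable[OF X[OF that]] by simp
  have indep_Suc: "indep_vars (\<lambda>_. borel) (\<lambda>i. X (Suc i)) UNIV"
  proof -
    have "indep_vars (\<lambda>i. PiM {Suc i} (\<lambda>_. borel)) (\<lambda>i \<omega>. restrict (\<lambda>i. X i \<omega>) {Suc i}) UNIV"
      by (rule indep_vars_restrict[OF indep]) (auto simp: disjoint_family_on_def)
    from indep_vars_compose2[OF this, of "\<lambda>i f. f (Suc i)" "\<lambda>_. borel"] show ?thesis
      by simp
  qed
  have clt: "weak_conv_m (\<lambda>n. distr M borel (S n)) std_normal_distribution"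
    unfolding S_def[abs_def] by (rule exponential_clt[OF X indep_Suc]) simp
  have S: "S n \<in> borel_measurable M" for n
    unfolding S_def[abs_def] using Xm by (intro borel_measurable_divide borel_measurable_sum borel_measurable_diff) auto
  have c: "(\<lambda>n. sqrt (real (hi n - lo n)) / sqrt (real n)) \<longlonglongrightarrow> sqrt v"
    using tendsto_real_sqrt[OF v] by (simp add: real_sqrt_divide)
  have eq: "distr M borel (\<lambda>\<omega>. sqrt (real (hi n - lo n)) / sqrt (real n) * S (hi n - lo n) \<omega>)
    = distr M borel (\<lambda>\<omega>. (\<Sum>i\<in>{lo n<..hi n}. X i \<omega> - 1) / sqrt (real n))" for n
  proof -
    define m where "m = hi n - lo n"
    let ?g = "\<lambda>x :: real. (x - real m) / sqrt (real n)"
    have "sqrt (real m) / sqrt (real n) * S m \<omega> = ?g (\<Sum>i<m. X (Suc i) \<omega>)" for \<omega>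
      by (cases "m = 0") (simp_all add: S_def sum_subtractf)
    then have "distr M borel (\<lambda>\<omega>. sqrt (real m) / sqrt (real n) * S m \<omega>)
        = distr M borel (\<lambda>\<omega>. ?g (\<Sum>i<m. X (Suc i) \<omega>))"
      by (simp only:)
    also have "\<dots> = distr (distr M borel (\<lambda>\<omega>. \<Sum>i<m. X (Suc i) \<omega>)) borel ?g"
      using Xm by (subst distr_distr) (auto simp: comp_def intro!: borel_measurable_sum)
    also have "distr M borel (\<lambda>\<omega>. \<Sum>i<m. X (Suc i) \<omega>) = distr M borel (\<lambda>\<omega>. \<Sum>i\<in>{lo n<..hi n}. X i \<omega>)"
      by (rule distr_exponential_sum_cong)
        (auto simp: m_def intro: X indep_vars_subset[OF indep_Suc] indep_vars_subset[OF indep])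
    also have "distr (distr M borel (\<lambda>\<omega>. \<Sum>i\<in>{lo n<..hi n}. X i \<omega>)) borel ?g
        = distr M borel (\<lambda>\<omega>. (\<Sum>i\<in>{lo n<..hi n}. X i \<omega> - 1) / sqrt (real n))"
      using Xm by (subst distr_distr) (auto simp: comp_def m_def sum_subtractf intro!: borel_measurable_sum)
    finally show ?thesis unfolding m_def .
  qed
  show ?thesis
    using weak_conv_m_rescale[OF prob_space_axioms S real_dist_normal_dist clt r c] unfolding eq .
qed

lemma cmod_iexp_diff_le: "cmod (iexp a - iexp b) \<le> \<bar>a - b\<bar>"
proof -
  have "iexp a - iexp b = iexp b * (iexp (a - b) - 1)"
    by (simp add: algebra_simps exp_add[symmetric])
  then have "cmod (iexp a - iexp b) = cmod (iexp (a - b) - 1)" by (simp add: norm_mult)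
  also have "\<dots> \<le> \<bar>a - b\<bar>" using iexp_approx1[of "a - b" 0] by simp
  finally show ?thesis .
qed

text \<open>The function \<open>x \<mapsto> exp (i t x)\<close> has Lipschitz constant \<open>\<bar>t\<bar>\<close> and modulus 1; the two properties are used
  outside and inside \<open>E\<close>.\<close>

lemma (in prob_space) iexp_integral_diff_le:
  assumes X: "X \<in> borel_measurable M" and Y: "Y \<in> borel_measurable M" and E: "E \<in> events"
    and close: "\<And>\<omega>. \<omega> \<in> space M \<Longrightarrow> \<omega> \<notin> E \<Longrightarrow> \<bar>X \<omega> - Y \<omega>\<bar> \<le> \<delta>" and "0 \<le> \<delta>"
  shows "cmod ((CLINT \<omega>|M. iexp (t * X \<omega>)) - (CLINT \<omega>|M. iexp (t * Y \<omega>))) \<le> \<bar>t\<bar> * \<delta> + 2 * prob E"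
proof -
  have int: "integrable M (\<lambda>\<omega>. iexp (t * Z \<omega>))" if "Z \<in> borel_measurable M" for Z
    using that by (intro integrable_const_bound[where B=1]) auto
  have intE: "integrable M (indicat_real E)"
    by (rule integrable_const_bound[where B=1]) (use E in auto)
  then have int': "integrable M (\<lambda>\<omega>. \<bar>t\<bar> * \<delta> + 2 * indicat_real E \<omega>)"
    by (intro Bochner_Integration.integrable_add integrable_mult_right integrable_const)
  have "cmod ((CLINT \<omega>|M. iexp (t * X \<omega>)) - (CLINT \<omega>|M. iexp (t * Y \<omega>)))
      = cmod (CLINT \<omega>|M. iexp (t * X \<omega>) - iexp (t * Y \<omega>))"
    by (subst Bochner_Integration.integral_diff[OF int[OF X] int[OF Y]]) (rule refl)
  also have "\<dots> \<le> (LINT \<omega>|M. cmod (iexp (t * X \<omega>) - iexp (t * Y \<omega>)))"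
    by (rule integral_norm_bound)
  also have "\<dots> \<le> (LINT \<omega>|M. \<bar>t\<bar> * \<delta> + 2 * indicat_real E \<omega>)"
  proof (rule integral_mono[OF _ int'])
    show "integrable M (\<lambda>\<omega>. cmod (iexp (t * X \<omega>) - iexp (t * Y \<omega>)))"
      by (intro integrable_norm Bochner_Integration.integrable_diff int X Y)
    fix \<omega> assume \<omega>: "\<omega> \<in> space M"
    show "cmod (iexp (t * X \<omega>) - iexp (t * Y \<omega>)) \<le> \<bar>t\<bar> * \<delta> + 2 * indicat_real E \<omega>"
    proof (cases "\<omega> \<in> E")
      case True
      have "cmod (iexp (t * X \<omega>) - iexp (t * Y \<omega>)) \<le> cmod (iexp (t * X \<omega>)) + cmod (iexp (t * Y \<omega>))"
        by (rule norm_triangle_ineq4)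
      moreover have "0 \<le> \<bar>t\<bar> * \<delta>" using \<open>0 \<le> \<delta>\<close> by simp
      ultimately show ?thesis using True by simp
    next
      case False
      have "cmod (iexp (t * X \<omega>) - iexp (t * Y \<omega>)) \<le> \<bar>t * X \<omega> - t * Y \<omega>\<bar>" by (rule cmod_iexp_diff_le)
      also have "\<dots> = \<bar>t\<bar> * \<bar>X \<omega> - Y \<omega>\<bar>" by (simp add: abs_mult[symmetric] algebra_simps)
      also have "\<dots> \<le> \<bar>t\<bar> * \<delta>" using close[OF \<omega> False] by (intro mult_left_mono) auto
      finally show ?thesis using False by simp
    qed
  qed
  also have "\<dots> = (LINT \<omega>|M. \<bar>t\<bar> * \<delta>) + (LINT \<omega>|M. 2 * indicat_real E \<omega>)"
    using intE by (intro Bochner_Integration.integral_add integrable_mult_right integrable_const)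
  also have "\<dots> = \<bar>t\<bar> * \<delta> + 2 * prob E"
    using sets.Int_space_eq2[OF E] by (simp add: prob_space)
  finally show ?thesis .
qed

section \<open>Comparison with the walks sampled on a grid\<close>

text \<open>The walk after rescaling time by \<open>M\<close> makes the steps \<open>block_start M L l + 1\<close> to
  \<open>block_start M L (l + 1)\<close> in the grid cell between \<open>l / L\<close> and \<open>(l + 1) / L\<close>.\<close>

definition block_start :: "nat \<Rightarrow> nat \<Rightarrow> nat \<Rightarrow> nat" where
  "block_start M L l = nat \<lfloor>real M * (real l / real L)\<rfloor>"

lemma block_start_mono: "l \<le> l' \<Longrightarrow> block_start M L l \<le> block_start M L l'"
  unfolding block_start_def by (intro nat_mono floor_mono mult_left_mono divide_right_mono) auto

lemma block_length:
  assumes "1 \<le> L"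
  shows "\<bar>real (block_start M L (Suc l) - block_start M L l) - real M / real L\<bar> \<le> 1"
proof -
  define x where "x = real M * (real l / real L)"
  define y where "y = real M * (real (Suc l) / real L)"
  have y: "y = x + real M / real L" by (simp add: x_def y_def add_divide_distrib algebra_simps)
  have "0 \<le> x" "x \<le> y" by (simp_all add: x_def y)
  then have "real (nat \<lfloor>y\<rfloor> - nat \<lfloor>x\<rfloor>) = of_int \<lfloor>y\<rfloor> - of_int \<lfloor>x\<rfloor>"
    by (simp add: nat_mono floor_mono of_nat_diff)
  then show ?thesis
    unfolding block_start_def x_def[symmetric] y_def[symmetric] y[symmetric] using y by linarith
qed

lemma rescaled_walk_diff:
  assumes "nat \<lfloor>real M * s\<rfloor> \<le> nat \<lfloor>real M * t\<rfloor>"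
  shows "rescaled_walk M w j t - rescaled_walk M w j s
    = (\<Sum>i\<in>{nat \<lfloor>real M * s\<rfloor><..nat \<lfloor>real M * t\<rfloor>}. w i j - 1) / sqrt (real M)"
proof -
  have "{1..nat \<lfloor>real M * t\<rfloor>} = {1..nat \<lfloor>real M * s\<rfloor>} \<union> {nat \<lfloor>real M * s\<rfloor><..nat \<lfloor>real M * t\<rfloor>}"
    using assms by auto
  then have "(\<Sum>i\<in>{1..nat \<lfloor>real M * t\<rfloor>}. w i j - 1)
    = (\<Sum>i\<in>{1..nat \<lfloor>real M * s\<rfloor>}. w i j - 1) + (\<Sum>i\<in>{nat \<lfloor>real M * s\<rfloor><..nat \<lfloor>real M * t\<rfloor>}. w i j - 1)"
    by (simp only:) (intro sum.union_disjoint; auto)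
  then show ?thesis unfolding rescaled_walk_def by (simp add: add_divide_distrib)
qed

lemma rescaled_walk_block:
  "rescaled_walk M w j (real (Suc l) / real L) - rescaled_walk M w j (real l / real L)
    = (\<Sum>i\<in>{block_start M L l<..block_start M L (Suc l)}. w i j - 1) / sqrt (real M)"
  using rescaled_walk_diff[of M "real l / real L" "real (Suc l) / real L" w j]
    block_start_mono[of l "Suc l" M L] unfolding block_start_def by simp

lemma rescaled_walk_grid_close:
  assumes L: "1 \<le> L" and M: "1 \<le> M" and \<eta>: "0 \<le> \<eta>" and t: "t \<in> {0..1}"
    and osc: "\<And>l n. l < L \<Longrightarrow> n \<in> {block_start M L l..block_start M L (Suc l)} \<Longrightarrow>
      \<bar>\<Sum>i\<in>{block_start M L l<..n}. w i j - 1\<bar> \<le> \<eta> * sqrt (real M)"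
  shows "\<bar>rescaled_walk M w j t - rescaled_walk M w j (grid_floor L t)\<bar> \<le> \<eta>"
proof -
  define l where "l = nat \<lfloor>real L * t\<rfloor>"
  have Lt: "0 \<le> real L * t" using t by simp
  have l: "real l \<le> real L * t" "real L * t < real l + 1" using Lt unfolding l_def by linarith+
  have g: "grid_floor L t = real l / real L" by (simp add: grid_floor_def l_def)
  have le: "real l / real L \<le> t" using l(1) L by (simp add: divide_simps mult.commute)
  show ?thesis
  proof (cases "l < L")
    case True
    have lt: "t \<le> real (Suc l) / real L" using l(2) L by (simp add: divide_simps mult.commute)
    have b: "nat \<lfloor>real M * (real l / real L)\<rfloor> \<le> nat \<lfloor>real M * t\<rfloor>"
      "nat \<lfloor>real M * t\<rfloor> \<le> nat \<lfloor>real M * (real (Suc l) / real L)\<rfloor>"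
      using le lt by (intro nat_mono floor_mono mult_left_mono; simp)+
    have "\<bar>\<Sum>i\<in>{block_start M L l<..nat \<lfloor>real M * t\<rfloor>}. w i j - 1\<bar> \<le> \<eta> * sqrt (real M)"
      using b by (intro osc[OF True]) (simp add: block_start_def)
    then show ?thesis
      unfolding g rescaled_walk_diff[OF b(1)] block_start_def[symmetric]
      using M by (simp add: divide_simps)
  next
    case False
    then have "real L \<le> real L * t" using l(1) by linarith
    then have "t = 1" using t L by simp
    then have "grid_floor L t = t" using L by (simp add: grid_floor_def)
    then show ?thesis using \<eta> by simp
  qed
qed

lemma rescaled_walk_abs_le:
  assumes "j \<in> {1..N}" "t \<in> {0..1}"
  shows "\<bar>rescaled_walk M w j t\<bar> \<le> (\<Sum>j=1..N. \<Sum>i=1..M. \<bar>w i j - 1\<bar>) / sqrt (real M)"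
proof -
  have "\<bar>\<Sum>i=1..nat \<lfloor>real M * t\<rfloor>. w i j - 1\<bar> \<le> (\<Sum>i=1..nat \<lfloor>real M * t\<rfloor>. \<bar>w i j - 1\<bar>)"
    by (rule sum_abs)
  also have "\<dots> \<le> (\<Sum>i=1..M. \<bar>w i j - 1\<bar>)"
    using nat_floor_le[OF assms(2), of M] by (intro sum_mono2) auto
  also have "\<dots> \<le> (\<Sum>j=1..N. \<Sum>i=1..M. \<bar>w i j - 1\<bar>)"
    using assms(1) by (intro member_le_sum[where f="\<lambda>j. \<Sum>i=1..M. \<bar>w i j - 1\<bar>"]) (auto intro: sum_nonneg)
  finally have "\<bar>\<Sum>i=1..nat \<lfloor>real M * t\<rfloor>. w i j - 1\<bar> \<le> (\<Sum>j=1..N. \<Sum>i=1..M. \<bar>w i j - 1\<bar>)" .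
  then show ?thesis unfolding rescaled_walk_def abs_divide by (simp add: divide_right_mono)
qed

lemma H_grid_approx:
  assumes k: "1 \<le> k" and kN: "k \<le> N" and kM: "k \<le> M" and L: "1 \<le> L" and \<eta>: "0 \<le> \<eta>"
    and w: "\<And>i j. i \<in> {1..M} \<Longrightarrow> j \<in> {1..N} \<Longrightarrow> 0 \<le> w i j \<and> w i j \<le> \<eta> * sqrt (real M)"
    and osc: "\<And>j l n. j \<in> {1..N} \<Longrightarrow> l < L \<Longrightarrow> n \<in> {block_start M L l..block_start M L (Suc l)} \<Longrightarrow>
      \<bar>\<Sum>i\<in>{block_start M L l<..n}. w i j - 1\<bar> \<le> \<eta> * sqrt (real M)"
  shows "\<bar>(H k M N w - real k * real M) / sqrt (real M)
      - Omega k N (\<lambda>j t. rescaled_walk M w j (grid_floor L t))\<bar>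
    \<le> (2 * real N ^ 3 + 2 * real N * real k) * \<eta>"
proof -
  have M: "1 \<le> M" using k kM by simp
  have "\<bar>(H k M N w - real k * real M) / sqrt (real M) - Omega k N (rescaled_walk M w)\<bar>
      \<le> 2 * real N ^ 3 * (\<eta> * sqrt (real M) / sqrt (real M))"
    by (rule H_approx[OF k kN kM w])
  moreover have "\<eta> * sqrt (real M) / sqrt (real M) = \<eta>" using M by simp
  moreover have "\<bar>Omega k N (rescaled_walk M w) - Omega k N (\<lambda>j t. rescaled_walk M w j (grid_floor L t))\<bar>
      \<le> 2 * real N * real k * \<eta>"
  proof (rule Omega_abs_diff_le[OF kN])
    fix j t assume jt: "j \<in> {1..N}" "t \<in> {0..1::real}"
    show "\<bar>rescaled_walk M w j t\<bar> \<le> (\<Sum>j=1..N. \<Sum>i=1..M. \<bar>w i j - 1\<bar>) / sqrt (real M)"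
      by (rule rescaled_walk_abs_le[OF jt])
    show "\<bar>rescaled_walk M w j (grid_floor L t)\<bar> \<le> (\<Sum>j=1..N. \<Sum>i=1..M. \<bar>w i j - 1\<bar>) / sqrt (real M)"
      by (rule rescaled_walk_abs_le[OF jt(1) grid_floor_range[OF jt(2)]])
    show "\<bar>rescaled_walk M w j t - rescaled_walk M w j (grid_floor L t)\<bar> \<le> \<eta>"
      by (rule rescaled_walk_grid_close[OF L M \<eta> jt(2)]) (rule osc[OF jt(1)])
  qed
  ultimately show ?thesis by (simp add: distrib_right)
qed

lemma (in prob_space) indep_vars_row:
  assumes "indep_vars (\<lambda>_. borel) (\<lambda>(i, j). w i j) ({1..} \<times> {1..})" "1 \<le> (j::nat)"
  shows "indep_vars (\<lambda>_. borel) (\<lambda>i. w i j) {1::nat..}"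
proof -
  have "indep_vars (\<lambda>i. PiM {(i, j)} (\<lambda>_. borel)) (\<lambda>i \<omega>. restrict (\<lambda>x. (case x of (i, j) \<Rightarrow> w i j) \<omega>) {(i, j)}) {1..}"
    using assms by (intro indep_vars_restrict[OF assms(1)]) (auto simp: disjoint_family_on_def)
  from indep_vars_compose2[OF this, of "\<lambda>i f. f (i, j)" "\<lambda>_. borel"] show ?thesis by simp
qed

text \<open>There are \<open>N * L\<close> blocks of length about \<open>m / L\<close>, and each has a large oscillation with probability of order
  \<open>1 / L\<^sup>2\<close>, so the bound is uniform in \<open>m\<close> and vanishes as \<open>L\<close> grows.\<close>

lemma (in prob_space) oscillation_event:
  fixes w :: "nat \<Rightarrow> nat \<Rightarrow> 'a \<Rightarrow> real"
  assumes L: "1 \<le> L" and LM: "L \<le> m" and \<eta>: "0 < \<eta>"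
    and indep: "indep_vars (\<lambda>_. borel) (\<lambda>(i, j). w i j) ({1..} \<times> {1..})"
    and w: "\<And>i j. 1 \<le> i \<Longrightarrow> 1 \<le> j \<Longrightarrow> distributed M lborel (w i j) (exponential_density 1)"
  obtains E where "E \<in> events" "prob E \<le> 1152 * real N / (real L * \<eta> ^ 4)"
    "\<forall>\<omega>\<in>space M - E. \<forall>j\<in>{1..N}. \<forall>l<L. \<forall>n\<in>{block_start m L l..block_start m L (Suc l)}.
      \<bar>\<Sum>i\<in>{block_start m L l<..n}. w i j \<omega> - 1\<bar> \<le> \<eta> * sqrt (real m)"
proof -
  define c where "c = \<eta> * sqrt (real m) / 2"
  have m: "1 \<le> m" using L LM by simp
  have c: "0 < c" using \<eta> m by (simp add: c_def)
  let ?a = "block_start m L"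
  define F where "F = (\<lambda>(j, l). {\<omega>\<in>space M. \<exists>n\<in>{?a l..?a (Suc l)}. 2 * c \<le> \<bar>\<Sum>i\<in>{?a l<..n}. w i j \<omega> - 1\<bar>})"
  have meas: "w i j \<in> borel_measurable M" if "1 \<le> i" "1 \<le> j" for i j
    using distributed_measurable[OF w[OF that]] by simp
  have F_ev: "F (j, l) \<in> events" if j: "1 \<le> j" for j l
  proof -
    have "{\<omega>\<in>space M. 2 * c \<le> \<bar>\<Sum>i\<in>{?a l<..n}. w i j \<omega> - 1\<bar>} \<in> events" for n
    proof -
      have "(\<lambda>\<omega>. \<Sum>i\<in>{?a l<..n}. w i j \<omega> - 1) \<in> borel_measurable M"
        using j by (intro borel_measurable_sum borel_measurable_diff meas) auto
      then show ?thesis by measurable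
    qed
    then show ?thesis unfolding F_def prod.case by (intro sets.sets_Collect_finite_Ex) auto
  qed
  have F_prob: "prob (F (j, l)) \<le> 1152 / ((real L)\<^sup>2 * \<eta> ^ 4)" if j: "1 \<le> j" for j l
  proof -
    have "prob (F (j, l)) \<le> 18 * (real (?a (Suc l) - ?a l))\<^sup>2 / c ^ 4"
      unfolding F_def prod.case
      using j by (intro exponential_walk_oscillation c w indep_vars_subset[OF indep_vars_row[OF indep]]) auto
    also have "\<dots> \<le> 18 * (2 * real m / real L)\<^sup>2 / c ^ 4"
    proof -
      have "real (?a (Suc l) - ?a l) \<le> real m / real L + 1" using block_length[OF L, of m l] by linarith
      also have "\<dots> \<le> 2 * real m / real L" using L LM by (simp add: field_simps)
      finally show ?thesis using c by (intro divide_right_mono mult_left_mono power_mono) auto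
    qed
    also have "\<dots> = 1152 / ((real L)\<^sup>2 * \<eta> ^ 4)"
    proof -
      have "sqrt (real m) ^ 4 = (sqrt (real m) ^ 2) ^ 2" by (subst power_mult[symmetric]) simp
      then have c4: "c ^ 4 = \<eta> ^ 4 * (real m)\<^sup>2 / 16"
        by (simp add: c_def power_divide power_mult_distrib)
      show ?thesis unfolding c4 using m L \<eta> by (simp add: field_simps)
    qed
    finally show ?thesis .
  qed
  show ?thesis
  proof (rule that[of "\<Union>x\<in>{1..N} \<times> {..<L}. F x"])
    show "(\<Union>x\<in>{1..N} \<times> {..<L}. F x) \<in> events"
      using F_ev by (intro sets.finite_UN) auto
    have "prob (\<Union>x\<in>{1..N} \<times> {..<L}. F x) \<le> (\<Sum>x\<in>{1..N} \<times> {..<L}. prob (F x))"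
      using F_ev by (intro measure_UNION_le) auto
    also have "\<dots> \<le> (\<Sum>x\<in>{1..N} \<times> {..<L}. 1152 / ((real L)\<^sup>2 * \<eta> ^ 4))"
    proof (rule sum_mono)
      fix x assume "x \<in> {1..N} \<times> {..<L}"
      then show "prob (F x) \<le> 1152 / ((real L)\<^sup>2 * \<eta> ^ 4)" using F_prob[of "fst x" "snd x"] by auto
    qed
    also have "\<dots> = 1152 * real N / (real L * \<eta> ^ 4)"
      using L by (simp add: power2_eq_square)
    finally show "prob (\<Union>x\<in>{1..N} \<times> {..<L}. F x) \<le> 1152 * real N / (real L * \<eta> ^ 4)" .
  next
    show "\<forall>\<omega>\<in>space M - (\<Union>x\<in>{1..N} \<times> {..<L}. F x). \<forall>j\<in>{1..N}. \<forall>l<L. \<forall>n\<in>{?a l..?a (Suc l)}.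
      \<bar>\<Sum>i\<in>{?a l<..n}. w i j \<omega> - 1\<bar> \<le> \<eta> * sqrt (real m)"
    proof (intro ballI allI impI)
      fix \<omega> j l n
      assume "\<omega> \<in> space M - (\<Union>x\<in>{1..N} \<times> {..<L}. F x)" and "j \<in> {1..N}" "l < L" and n: "n \<in> {?a l..?a (Suc l)}"
      then have \<omega>: "\<omega> \<in> space M" "\<omega> \<notin> F (j, l)" by blast+
      then have "\<not> 2 * c \<le> \<bar>\<Sum>i\<in>{?a l<..n}. w i j \<omega> - 1\<bar>"
        using \<omega>(1) n unfolding F_def by blast
      then show "\<bar>\<Sum>i\<in>{?a l<..n}. w i j \<omega> - 1\<bar> \<le> \<eta> * sqrt (real m)" by (simp add: c_def)
    qed
  qed
qed

text \<open>Negative weights occur with probability 0 only, not nowhere, so they are made part of the exceptional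
  event.\<close>

lemma (in prob_space) extreme_weight_event:
  fixes w :: "nat \<Rightarrow> nat \<Rightarrow> 'a \<Rightarrow> real"
  assumes c: "0 \<le> c"
    and w: "\<And>i j. 1 \<le> i \<Longrightarrow> 1 \<le> j \<Longrightarrow> distributed M lborel (w i j) (exponential_density 1)"
  obtains E where "E \<in> events" "prob E \<le> real m * real N * exp (- c)"
    "\<forall>\<omega>\<in>space M - E. \<forall>i\<in>{1..m}. \<forall>j\<in>{1..N}. 0 \<le> w i j \<omega> \<and> w i j \<omega> \<le> c"
proof -
  define F where "F = (\<lambda>(i, j). {\<omega>\<in>space M. w i j \<omega> < 0} \<union> {\<omega>\<in>space M. c < w i j \<omega>})"
  have meas: "w i j \<in> borel_measurable M" if "1 \<le> i" "1 \<le> j" for i j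
    using distributed_measurable[OF w[OF that]] by simp
  have ev: "{\<omega>\<in>space M. w i j \<omega> < 0} \<in> events" "{\<omega>\<in>space M. w i j \<omega> \<le> 0} \<in> events"
    "{\<omega>\<in>space M. c < w i j \<omega>} \<in> events" if "1 \<le> i" "1 \<le> j" for i j
    using meas[OF that] by measurable
  have F_ev: "F (i, j) \<in> events" if "1 \<le> i" "1 \<le> j" for i j
    unfolding F_def prod.case by (intro sets.Un ev that)
  have F_prob: "prob (F (i, j)) \<le> exp (- c)" if ij: "1 \<le> i" "1 \<le> j" for i j
  proof -
    have "prob (F (i, j)) \<le> prob {\<omega>\<in>space M. w i j \<omega> < 0} + prob {\<omega>\<in>space M. c < w i j \<omega>}"
      unfolding F_def prod.case by (intro measure_Un_le ev ij)
    also have "prob {\<omega>\<in>space M. w i j \<omega> < 0} \<le> prob {\<omega>\<in>space M. w i j \<omega> \<le> 0}"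
      by (intro finite_measure_mono ev ij) auto
    also have "\<dots> = 0" using exponential_distributedD_le[OF w[OF ij], of 0] by simp
    also have "prob {\<omega>\<in>space M. c < w i j \<omega>} = exp (- c)"
      using exponential_distributedD_gt[OF w[OF ij] c] by simp
    finally show ?thesis by simp
  qed
  show ?thesis
  proof (rule that[of "\<Union>x\<in>{1..m} \<times> {1..N}. F x"])
    show "(\<Union>x\<in>{1..m} \<times> {1..N}. F x) \<in> events"
      using F_ev by (intro sets.finite_UN) auto
    have "prob (\<Union>x\<in>{1..m} \<times> {1..N}. F x) \<le> (\<Sum>x\<in>{1..m} \<times> {1..N}. prob (F x))"
      using F_ev by (intro measure_UNION_le) auto
    also have "\<dots> \<le> (\<Sum>x\<in>{1..m} \<times> {1..N}. exp (- c))"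
    proof (rule sum_mono)
      fix x assume "x \<in> {1..m} \<times> {1..N}"
      then show "prob (F x) \<le> exp (- c)" using F_prob[of "fst x" "snd x"] by auto
    qed
    finally show "prob (\<Union>x\<in>{1..m} \<times> {1..N}. F x) \<le> real m * real N * exp (- c)" by simp
  next
    show "\<forall>\<omega>\<in>space M - (\<Union>x\<in>{1..m} \<times> {1..N}. F x). \<forall>i\<in>{1..m}. \<forall>j\<in>{1..N}. 0 \<le> w i j \<omega> \<and> w i j \<omega> \<le> c"
    proof (intro ballI)
      fix \<omega> i j
      assume "\<omega> \<in> space M - (\<Union>x\<in>{1..m} \<times> {1..N}. F x)" and "i \<in> {1..m}" "j \<in> {1..N}"
      then have "\<omega> \<in> space M" "\<omega> \<notin> F (i, j)" by blast+
      then show "0 \<le> w i j \<omega> \<and> w i j \<omega> \<le> c" by (auto simp: F_def)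
    qed
  qed
qed

lemma (in prob_space) walk_increments_indep:
  fixes w :: "nat \<Rightarrow> nat \<Rightarrow> 'a \<Rightarrow> real"
  assumes indep: "indep_vars (\<lambda>_. borel) (\<lambda>(i, j). w i j) ({1..} \<times> {1..})"
  shows "indep_vars (\<lambda>_. borel) (\<lambda>(j, l) \<omega>. (\<Sum>i\<in>{block_start m L l<..block_start m L (Suc l)}. w i j \<omega> - 1) / sqrt (real m))
    ({1..N} \<times> {..<L})"
proof -
  define K where "K = (\<lambda>(j, l). {block_start m L l<..block_start m L (Suc l)} \<times> {j::nat})"
  have disj: "{block_start m L l<..block_start m L (Suc l)} \<inter> {block_start m L l'<..block_start m L (Suc l')} = {}"
    if "l < l'" for l l'
    using block_start_mono[of "Suc l" l' m L] that by auto
  have "disjoint_family_on K ({1..N} \<times> {..<L})"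
    unfolding disjoint_family_on_def
  proof (intro ballI impI)
    fix x y assume "x \<in> {1..N} \<times> {..<L}" "y \<in> {1..N} \<times> {..<L}" and "x \<noteq> y"
    then show "K x \<inter> K y = {}"
      using disj[of "snd x" "snd y"] disj[of "snd y" "snd x"]
      by (cases x; cases y) (auto simp: K_def neq_iff)
  qed
  moreover have "K x \<subseteq> {1..} \<times> {1..}" if "x \<in> {1..N} \<times> {..<L}" for x
    using that by (auto simp: K_def)
  ultimately have *: "indep_vars (\<lambda>x. PiM (K x) (\<lambda>_. borel))
      (\<lambda>x \<omega>. restrict (\<lambda>y. (case y of (i, j) \<Rightarrow> w i j) \<omega>) (K x)) ({1..N} \<times> {..<L})"
    by (intro indep_vars_restrict[OF indep])
  define g where "g = (\<lambda>(j, l) (f :: nat \<times> nat \<Rightarrow> real).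
    (\<Sum>i\<in>{block_start m L l<..block_start m L (Suc l)}. f (i, j) - 1) / sqrt (real m))"
  have g: "g x \<in> borel_measurable (PiM (K x) (\<lambda>_. borel))" for x
    unfolding g_def K_def
    by (cases x) (auto intro!: borel_measurable_divide borel_measurable_sum borel_measurable_diff measurable_component_singleton)
  from indep_vars_compose2[OF * g]
  have "indep_vars (\<lambda>_. borel) (\<lambda>x \<omega>. g x (restrict (\<lambda>y. (case y of (i, j) \<Rightarrow> w i j) \<omega>) (K x))) ({1..N} \<times> {..<L})" .
  moreover have "g x (restrict (\<lambda>y. (case y of (i, j) \<Rightarrow> w i j) \<omega>) (K x))
      = (case x of (j, l) \<Rightarrow> \<lambda>\<omega>. (\<Sum>i\<in>{block_start m L l<..block_start m L (Suc l)}. w i j \<omega> - 1) / sqrt (real m)) \<omega>" for x \<omega>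
    by (cases x) (simp add: g_def K_def)
  ultimately show ?thesis by simp
qed

section \<open>Brownian increments on the grid\<close>

text \<open>Independence of the components as processes and independence of the increments of each component
  combine by factorising first over the rows and then within each row.\<close>

lemma standard_BM_increments_indep:
  assumes BM: "standard_BM_dim Q N B" and N: "1 \<le> N" and L: "1 \<le> L"
  shows "prob_space.indep_vars Q (\<lambda>_. borel)
    (\<lambda>(j, l) \<omega>. B j (real (Suc l) / real L) \<omega> - B j (real l / real L) \<omega>) ({1..N} \<times> {..<L})"
proof -
  interpret Q: prob_space Q using BM by (simp add: standard_BM_dim_def)
  have BMj: "standard_BM Q (B j)" if "j \<in> {1..N}" for j
    using BM that by (simp add: standard_BM_dim_def)
  have B: "B j t \<in> borel_measurable Q" if "j \<in> {1..N}" "0 \<le> t" for j t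
    using BMj[OF that(1)] that(2) by (simp add: standard_BM_def)
  define U where "U x \<omega> = B (fst x) (real (Suc (snd x)) / real L) \<omega> - B (fst x) (real (snd x) / real L) \<omega>"
    for x \<omega>
  have U: "U x \<in> borel_measurable Q" if "fst x \<in> {1..N}" for x
    unfolding U_def[abs_def] using that by (intro borel_measurable_diff B) auto
  define X where "X j \<omega> = (\<lambda>t\<in>{0..}. B j t \<omega>)" for j \<omega>
  have X: "Q.indep_vars (\<lambda>_. \<Pi>\<^sub>M t\<in>{0..}. borel) X {1..N}"
    using BM unfolding standard_BM_dim_def X_def by blast
  have inc: "Q.indep_vars (\<lambda>_. borel) (\<lambda>l. U (j, l)) {..<L}" if "j \<in> {1..N}" for j
  proof -
    have *: "\<forall>(t :: nat \<Rightarrow> real) n. 0 \<le> t 0 \<longrightarrow> (\<forall>i<n. t i \<le> t (Suc i)) \<longrightarrow>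
      Q.indep_vars (\<lambda>_. borel) (\<lambda>i \<omega>. B j (t (Suc i)) \<omega> - B j (t i) \<omega>) {..<n}"
      using BMj[OF that] by (simp add: standard_BM_def)
    have "Q.indep_vars (\<lambda>_. borel)
      (\<lambda>i \<omega>. B j ((\<lambda>l. real l / real L) (Suc i)) \<omega> - B j ((\<lambda>l. real l / real L) i) \<omega>) {..<L}"
      by (rule *[rule_format]) (auto intro: divide_right_mono)
    then show ?thesis by (simp add: U_def[abs_def])
  qed
  let ?I = "{1..N} \<times> {..<L}"
  have "Q.indep_vars (\<lambda>_. borel) U ?I \<longleftrightarrow> (\<forall>A\<in>(\<Pi> x\<in>?I. sets (borel :: real measure)).
    Q.prob (\<Inter>x\<in>?I. U x -` A x \<inter> space Q) = (\<Prod>x\<in>?I. Q.prob (U x -` A x \<inter> space Q)))"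
  proof (rule Q.indep_vars_finite)
    show "?I \<noteq> {}" using N L by (auto simp: lessThan_empty_iff)
    show "sets borel = sigma_sets (space borel) (sets (borel :: real measure))"
      by (rule sets.sigma_sets_eq[symmetric])
    show "Int_stable (sets (borel :: real measure))" by (auto simp: Int_stable_def)
    show "sets (borel :: real measure) \<subseteq> Pow (space borel)" by simp
  qed (use U in auto)
  also have "\<dots>"
  proof
    fix A assume A: "A \<in> (\<Pi> x\<in>?I. sets (borel :: real measure))"
    define G where "G j = {f\<in>space (\<Pi>\<^sub>M t\<in>{0..}. borel).
      \<forall>l\<in>{..<L}. f (real (Suc l) / real L) - f (real l / real L) \<in> A (j, l)}" for j
    have G: "G j \<in> sets (\<Pi>\<^sub>M t\<in>{0..}. borel)" if j: "j \<in> {1..N}" for j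
      unfolding G_def
    proof (rule sets.sets_Collect_finite_All)
      fix l assume l: "l \<in> {..<L}"
      have [measurable]: "A (j, l) \<in> sets borel" using A j l by auto
      have "(\<lambda>f. f (real (Suc l) / real L) - f (real l / real L)) \<in> borel_measurable (\<Pi>\<^sub>M t\<in>{0::real..}. borel :: real measure)"
        by (intro borel_measurable_diff measurable_component_singleton) auto
      then show "{f\<in>space (\<Pi>\<^sub>M t\<in>{0..}. borel). f (real (Suc l) / real L) - f (real l / real L) \<in> A (j, l)}
          \<in> sets (\<Pi>\<^sub>M t\<in>{0..}. borel)"
        by measurable
    qed simp
    have XG: "X j -` G j \<inter> space Q = (\<Inter>l\<in>{..<L}. U (j, l) -` A (j, l) \<inter> space Q)" for j
      using L by (auto simp: G_def X_def U_def space_PiM lessThan_empty_iff)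
    have "(\<Inter>x\<in>?I. U x -` A x \<inter> space Q) = (\<Inter>j\<in>{1..N}. X j -` G j \<inter> space Q)"
      unfolding XG by auto
    also have "Q.prob \<dots> = (\<Prod>j\<in>{1..N}. Q.prob (X j -` G j \<inter> space Q))"
      using N by (intro Q.indep_varsD_finite[OF X _ _ G]) auto
    also have "\<dots> = (\<Prod>j\<in>{1..N}. \<Prod>l\<in>{..<L}. Q.prob (U (j, l) -` A (j, l) \<inter> space Q))"
    proof (rule prod.cong[OF refl])
      fix j assume j: "j \<in> {1..N}"
      show "Q.prob (X j -` G j \<inter> space Q) = (\<Prod>l\<in>{..<L}. Q.prob (U (j, l) -` A (j, l) \<inter> space Q))"
        unfolding XG using L A j by (intro Q.indep_varsD_finite[OF inc[OF j]]) (auto simp: lessThan_empty_iff)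
    qed
    also have "\<dots> = (\<Prod>x\<in>?I. Q.prob (U x -` A x \<inter> space Q))"
      by (simp add: prod.cartesian_product split_def)
    finally show "Q.prob (\<Inter>x\<in>?I. U x -` A x \<inter> space Q) = (\<Prod>x\<in>?I. Q.prob (U x -` A x \<inter> space Q))" .
  qed
  finally have "Q.indep_vars (\<lambda>_. borel) U ?I" by simp
  then show ?thesis by (simp add: U_def[abs_def] split_def)
qed

lemma standard_BM_increment_law:
  assumes BM: "standard_BM Q b" and L: "1 \<le> L"
  shows "distr Q borel (\<lambda>\<omega>. b (real (Suc l) / real L) \<omega> - b (real l / real L) \<omega>)
    = distr std_normal_distribution borel (\<lambda>x. sqrt (1 / real L) * x)"
proof -
  interpret Q: prob_space Q using BM by (simp add: standard_BM_def)
  let ?D = "\<lambda>\<omega>. b (real (Suc l) / real L) \<omega> - b (real l / real L) \<omega>"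
  let ?\<sigma> = "sqrt (1 / real L)"
  have \<sigma>: "0 < ?\<sigma>" using L by simp
  have D: "distributed Q lborel ?D (normal_density 0 (sqrt (real (Suc l) / real L - real l / real L)))"
    using BM L unfolding standard_BM_def by (auto simp: divide_strict_right_mono)
  also have "real (Suc l) / real L - real l / real L = 1 / real L" by (simp add: diff_divide_distrib[symmetric])
  finally have D: "distributed Q lborel ?D (normal_density 0 ?\<sigma>)" .
  then have std: "distributed Q lborel (\<lambda>\<omega>. (?D \<omega> - 0) / ?\<sigma>) std_normal_density"
    by (subst (asm) Q.normal_standard_normal_convert[OF \<sigma>])
  have meas: "(\<lambda>\<omega>. ?D \<omega> / ?\<sigma>) \<in> borel_measurable Q"
    using distributed_measurable[OF std] by simp
  have "distr Q borel (\<lambda>\<omega>. ?D \<omega> / ?\<sigma>) = distr Q lborel (\<lambda>\<omega>. (?D \<omega> - 0) / ?\<sigma>)"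
    by (rule distr_cong) simp_all
  also have "\<dots> = std_normal_distribution"
    by (rule distributed_distr_eq_density[OF std])
  finally have law: "distr Q borel (\<lambda>\<omega>. ?D \<omega> / ?\<sigma>) = std_normal_distribution" .
  have "distr std_normal_distribution borel (\<lambda>x. ?\<sigma> * x) = distr Q borel (\<lambda>\<omega>. ?\<sigma> * (?D \<omega> / ?\<sigma>))"
    unfolding law[symmetric] using meas by (subst distr_distr) (simp_all add: comp_def)
  also have "(\<lambda>\<omega>. ?\<sigma> * (?D \<omega> / ?\<sigma>)) = ?D" using L by (auto simp: fun_eq_iff)
  finally show ?thesis ..
qed

lemma Omega_step_path_restrict:
  "Omega k N (step_path L (restrict v ({1..N} \<times> {..<L}))) = Omega k N (step_path L v)"
proof (rule Omega_cong)
  fix j t assume jt: "j \<in> {1..N}" "t \<in> {0..1::real}"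
  show "step_path L (restrict v ({1..N} \<times> {..<L})) j t = step_path L v j t"
    unfolding step_path_def using jt(1) nat_floor_le[OF jt(2), of L] by (intro sum.cong) auto
qed

section \<open>Convergence in distribution\<close>

text \<open>For a fixed grid, \<open>Omega\<close> is a continuous function of finitely many independent block sums, each of which
  converges to the corresponding Brownian increment.\<close>

lemma (in prob_space) grid_functional_convergence:
  fixes w :: "nat \<Rightarrow> nat \<Rightarrow> 'a \<Rightarrow> real"
  assumes k: "1 \<le> k" and kN: "k \<le> N" and L: "1 \<le> L"
    and indep: "indep_vars (\<lambda>_. borel) (\<lambda>(i, j). w i j) ({1..} \<times> {1..})"
    and w: "\<And>i j. 1 \<le> i \<Longrightarrow> 1 \<le> j \<Longrightarrow> distributed M lborel (w i j) (exponential_density 1)"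
    and BM: "standard_BM_dim Q N B"
  defines "D \<equiv> \<lambda>m \<omega>. Omega k N (\<lambda>j s. rescaled_walk m (\<lambda>i j. w i j \<omega>) j (grid_floor L s))"
    and "D' \<equiv> \<lambda>\<omega>. Omega k N (\<lambda>j s. B j (grid_floor L s) \<omega>)"
  shows "D m \<in> borel_measurable M" "D' \<in> borel_measurable Q"
    "(\<lambda>m. CLINT \<omega>|M. iexp (t * D m \<omega>)) \<longlonglongrightarrow> (CLINT \<omega>|Q. iexp (t * D' \<omega>))"
proof -
  let ?I = "{1..N} \<times> {..<L}"
  have N: "1 \<le> N" using k kN by simp
  have QP: "prob_space Q" using BM by (simp add: standard_BM_dim_def)
  interpret Q: prob_space Q by (rule QP)
  define V where "V m = (\<lambda>(j, l) \<omega>. (\<Sum>i\<in>{block_start m L l<..block_start m L (Suc l)}. w i j \<omega> - 1) / sqrt (real m))"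
    for m
  define U where "U = (\<lambda>(j, l) \<omega>. B j (real (Suc l) / real L) \<omega> - B j (real l / real L) \<omega>)"
  have BMj: "standard_BM Q (B j)" if "j \<in> {1..N}" for j
    using BM that by (simp add: standard_BM_dim_def)
  have V_indep: "indep_vars (\<lambda>_. borel) (V m) ?I" for m
    unfolding V_def by (rule walk_increments_indep[OF indep])
  have U_indep: "Q.indep_vars (\<lambda>_. borel) U ?I"
    unfolding U_def by (rule standard_BM_increments_indep[OF BM N L])
  have V_rv: "V m x \<in> borel_measurable M" if "x \<in> ?I" for m x
    using V_indep[of m] that unfolding indep_vars_def by blast
  have U_rv: "U x \<in> borel_measurable Q" if "x \<in> ?I" for x
    using U_indep that unfolding Q.indep_vars_def by blast
  have D: "D m \<omega> = Omega k N (step_path L (\<lambda>x\<in>?I. V m x \<omega>))" for m \<omega>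
  proof -
    have "D m \<omega> = Omega k N (step_path L (\<lambda>(j, l). rescaled_walk m (\<lambda>i j. w i j \<omega>) j (real (Suc l) / real L)
        - rescaled_walk m (\<lambda>i j. w i j \<omega>) j (real l / real L)))"
      unfolding D_def by (rule Omega_grid_floor[OF L]) (simp add: rescaled_walk_def)
    also have "\<dots> = Omega k N (step_path L (\<lambda>x. V m x \<omega>))"
      unfolding rescaled_walk_block by (simp add: V_def split_def)
    finally show ?thesis by (simp only: Omega_step_path_restrict)
  qed
  have D': "D' \<omega> = Omega k N (step_path L (\<lambda>x\<in>?I. U x \<omega>))" if "\<omega> \<in> space Q" for \<omega>
  proof -
    have "D' \<omega> = Omega k N (step_path L (\<lambda>(j, l). B j (real (Suc l) / real L) \<omega> - B j (real l / real L) \<omega>))"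
      unfolding D'_def
      by (rule Omega_grid_floor[OF L, where b="\<lambda>j s. B j s \<omega>"]) (use BMj that in \<open>simp add: standard_BM_def\<close>)
    also have "\<dots> = Omega k N (step_path L (\<lambda>x. U x \<omega>))" by (simp add: U_def split_def)
    finally show ?thesis by (simp only: Omega_step_path_restrict)
  qed
  note meas = measurable_Omega_step_path[OF kN, of L]
  show "D m \<in> borel_measurable M" for m
  proof -
    have "(\<lambda>\<omega>. \<lambda>x\<in>?I. V m x \<omega>) \<in> measurable M (PiM ?I (\<lambda>_. borel))"
      by (intro measurable_restrict V_rv)
    from measurable_compose[OF this meas] show ?thesis unfolding D[symmetric] .
  qed
  show "D' \<in> borel_measurable Q"
  proof -
    have "(\<lambda>\<omega>. \<lambda>x\<in>?I. U x \<omega>) \<in> measurable Q (PiM ?I (\<lambda>_. borel))"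
      by (intro measurable_restrict U_rv)
    from measurable_compose[OF this meas] show ?thesis
      by (rule measurable_cong[THEN iffD1, rotated]) (simp only: D')
  qed
  define h where "h v = iexp (t * Omega k N (step_path L v))" for v
  have "(\<lambda>m. CLINT \<omega>|M. h (\<lambda>x\<in>?I. V m x \<omega>)) \<longlonglongrightarrow> (CLINT \<omega>|Q. h (\<lambda>x\<in>?I. U x \<omega>))"
  proof (rule indep_weak_conv_integral[where C=1])
    show "finite ?I" "?I \<noteq> {}" using N L by (auto simp: lessThan_empty_iff)
    show "prob_space M" by (rule prob_space_axioms)
    show "prob_space Q" by (rule QP)
    show "indep_vars (\<lambda>_. borel) (V n) ?I" for n by (rule V_indep)
    show "Q.indep_vars (\<lambda>_. borel) U ?I" by (rule U_indep)
    show "h \<in> borel_measurable (PiM ?I (\<lambda>_. borel))"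
      unfolding h_def using meas by measurable
    show "norm (h v) \<le> 1" for v by (simp add: h_def)
    show "(\<lambda>n. h (v n)) \<longlonglongrightarrow> h u" if "\<And>x. x \<in> ?I \<Longrightarrow> (\<lambda>n. v n x) \<longlonglongrightarrow> u x" for v u
      unfolding h_def by (intro tendsto_intros continuous_Omega_step_path[OF kN that])
    fix x assume "x \<in> ?I"
    then obtain j l where x: "x = (j, l)" and j: "j \<in> {1..N}" by blast
    have U_law: "distr Q borel (U x) = distr std_normal_distribution borel (\<lambda>y. sqrt (1 / real L) * y)"
      unfolding U_def x prod.case by (rule standard_BM_increment_law[OF BMj[OF j] L])
    show "weak_conv_m (\<lambda>n. distr M borel (V n x)) (distr Q borel (U x))"
      unfolding U_law unfolding V_def x prod.case
    proof (rule exponential_block_clt)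
      show "1 \<le> i \<Longrightarrow> distributed M lborel (w i j) (exponential_density 1)" for i using w j by simp
      show "indep_vars (\<lambda>_. borel) (\<lambda>i. w i j) {1..}" using j by (intro indep_vars_row[OF indep]) simp
      let ?r = "\<lambda>n. real (block_start n L (Suc l) - block_start n L l)"
      have "filterlim (\<lambda>n. - 1 + 1 / real L * real n) at_top sequentially"
        using L by (intro filterlim_tendsto_add_at_top[OF tendsto_const]
          filterlim_tendsto_pos_mult_at_top[OF tendsto_const] filterlim_real_sequentially) auto
      then have "filterlim ?r at_top sequentially"
      proof (rule filterlim_at_top_mono, intro always_eventually allI)
        fix n show "- 1 + 1 / real L * real n \<le> ?r n" using block_length[OF L, of n l] by (simp add: abs_le_iff)
      qed
      then show "filterlim (\<lambda>n. block_start n L (Suc l) - block_start n L l) at_top sequentially"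
        by (simp add: filterlim_sequentially_iff_filterlim_real)
      show "(\<lambda>n. ?r n / real n) \<longlonglongrightarrow> 1 / real L"
      proof (rule LIM_zero_cancel, rule Lim_null_comparison[OF _ lim_1_over_n])
        show "\<forall>\<^sub>F n in sequentially. norm (?r n / real n - 1 / real L) \<le> 1 / real n"
          using eventually_gt_at_top[of 0]
        proof eventually_elim
          case (elim n)
          have "?r n / real n - 1 / real L = (?r n - real n / real L) / real n"
            using elim by (simp add: diff_divide_distrib)
          then show ?case using block_length[OF L, of n l] by (simp add: divide_right_mono)
        qed
      qed
    qed
  qed
  also have "(CLINT \<omega>|Q. h (\<lambda>x\<in>?I. U x \<omega>)) = (CLINT \<omega>|Q. iexp (t * D' \<omega>))"
    unfolding h_def by (rule Bochner_Integration.integral_cong[OF refl]) (simp only: D')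
  finally show "(\<lambda>m. CLINT \<omega>|M. iexp (t * D m \<omega>)) \<longlonglongrightarrow> (CLINT \<omega>|Q. iexp (t * D' \<omega>))"
    unfolding h_def D[symmetric] .
qed

lemma measurable_H:
  assumes "\<And>i j. 1 \<le> i \<Longrightarrow> 1 \<le> j \<Longrightarrow> w i j \<in> borel_measurable M"
  shows "(\<lambda>\<omega>. H k n N (\<lambda>i j. w i j \<omega>)) \<in> borel_measurable M"
  unfolding H_eq
proof (rule borel_measurable_Max[OF finite_path_unions])
  fix A assume A: "A \<in> path_unions k n N"
  have "(\<lambda>\<omega>. w (fst x) (snd x) \<omega>) \<in> borel_measurable M" if "x \<in> A" for x
    using path_unions_subset[OF A] that by (intro assms) auto
  then show "(\<lambda>\<omega>. \<Sum>(i, j)\<in>A. w i j \<omega>) \<in> borel_measurable M"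
    unfolding split_def by (rule borel_measurable_sum)
qed

lemma tendsto_mult_exp_sqrt:
  assumes "0 < \<eta>"
  shows "(\<lambda>n. real n * exp (- (\<eta> * sqrt (real n)))) \<longlonglongrightarrow> 0"
proof -
  have "filterlim (\<lambda>n. \<eta> * sqrt (real n)) at_top sequentially"
    using assms by (intro filterlim_tendsto_pos_mult_at_top[OF tendsto_const] filterlim_compose[OF sqrt_at_top filterlim_real_sequentially])
  from filterlim_compose[OF tendsto_power_div_exp_0[of 2] this]
  have "(\<lambda>n. 1 / \<eta>\<^sup>2 * ((\<eta> * sqrt (real n)) ^ 2 / exp (\<eta> * sqrt (real n)))) \<longlonglongrightarrow> 1 / \<eta>\<^sup>2 * 0"
    by (intro tendsto_mult_left)
  moreover have "1 / \<eta>\<^sup>2 * ((\<eta> * sqrt (real n)) ^ 2 / exp (\<eta> * sqrt (real n))) = real n * exp (- (\<eta> * sqrt (real n)))" for n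
    using assms by (simp add: power_mult_distrib exp_minus field_simps)
  ultimately show ?thesis by simp
qed

theorem mainTheorem5:
  fixes k N :: nat
    and P :: "'a measure" and w :: "nat \<Rightarrow> nat \<Rightarrow> 'a \<Rightarrow> real"
    and Q :: "'b measure" and B :: "nat \<Rightarrow> real \<Rightarrow> 'b \<Rightarrow> real"
  assumes "1 \<le> k" and "k \<le> N"
    and "prob_space P"
    and "prob_space.indep_vars P (\<lambda>_. borel) (\<lambda>(i, j). w i j) ({1..} \<times> {1..})"
    and "\<And>i j. 1 \<le> i \<Longrightarrow> 1 \<le> j \<Longrightarrow> distributed P lborel (w i j) (exponential_density 1)"
    and "standard_BM_dim Q N B"
  shows "weak_conv_m
    (\<lambda>M. distr P borel (\<lambda>\<omega>. (H k M N (\<lambda>i j. w i j \<omega>) - real k * real M) / sqrt (real M)))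
    (distr Q borel (\<lambda>\<omega>. Omega k N (\<lambda>j t. B j t \<omega>)))"
proof -
  note k = assms(1) and kN = assms(2) and indep = assms(4) and w = assms(5) and BM = assms(6)
  interpret P: prob_space P by (rule assms(3))
  interpret Q: prob_space Q using BM by (simp add: standard_BM_dim_def)
  define Z where "Z M \<omega> = (H k M N (\<lambda>i j. w i j \<omega>) - real k * real M) / sqrt (real M)" for M \<omega>
  define D where "D L M \<omega> = Omega k N (\<lambda>j s. rescaled_walk M (\<lambda>i j. w i j \<omega>) j (grid_floor L s))" for L M \<omega>
  define D' where "D' L \<omega> = Omega k N (\<lambda>j s. B j (grid_floor L s) \<omega>)" for L \<omega>
  define Om where "Om \<omega> = Omega k N (\<lambda>j t. B j t \<omega>)" for \<omega>
  have Z: "Z M \<in> borel_measurable P" for M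
    unfolding Z_def[abs_def] using distributed_measurable[OF w]
    by (intro borel_measurable_divide borel_measurable_diff measurable_H) auto
  note grid = P.grid_functional_convergence[OF k kN _ indep w BM]
  have D: "D L M \<in> borel_measurable P" if "1 \<le> L" for L M
    unfolding D_def[abs_def] by (rule grid(1)[OF that])
  have D': "D' L \<in> borel_measurable Q" if "1 \<le> L" for L
    unfolding D'_def[abs_def] by (rule grid(2)[OF that])
  have DD': "(\<lambda>M. CLINT \<omega>|P. iexp (t * D L M \<omega>)) \<longlonglongrightarrow> (CLINT \<omega>|Q. iexp (t * D' L \<omega>))"
    if "1 \<le> L" for L t
    unfolding D_def D'_def by (rule grid(3)[OF that])
  have D'Om: "(\<lambda>L. D' L \<omega>) \<longlonglongrightarrow> Om \<omega>" if \<omega>: "\<omega> \<in> space Q" for \<omega>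
    unfolding D'_def Om_def
  proof (rule Omega_grid_approx[OF kN])
    fix j assume "j \<in> {1..N}"
    then have "continuous_on {0..} (\<lambda>t. B j t \<omega>)" using BM \<omega> by (simp add: standard_BM_dim_def standard_BM_def)
    then show "continuous_on {0..1} (\<lambda>t. B j t \<omega>)" by (rule continuous_on_subset) auto
  qed
  have Om: "Om \<in> borel_measurable Q"
  proof (rule borel_measurable_LIMSEQ_real)
    show "(\<lambda>n. D' (Suc n) \<omega>) \<longlonglongrightarrow> Om \<omega>" if "\<omega> \<in> space Q" for \<omega> by (rule LIMSEQ_Suc[OF D'Om[OF that]])
    show "D' (Suc n) \<in> borel_measurable Q" for n by (rule D') simp
  qed
  have char_D'Om: "(\<lambda>L. CLINT \<omega>|Q. iexp (t * D' L \<omega>)) \<longlonglongrightarrow> (CLINT \<omega>|Q. iexp (t * Om \<omega>))" for t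
  proof (rule LIMSEQ_imp_Suc, rule integral_dominated_convergence[where w="\<lambda>_. 1"])
    show "AE \<omega> in Q. (\<lambda>n. iexp (t * D' (Suc n) \<omega>)) \<longlonglongrightarrow> iexp (t * Om \<omega>)"
      by (intro AE_I2 tendsto_intros LIMSEQ_Suc[OF D'Om])
    show "(\<lambda>\<omega>. iexp (t * D' (Suc n) \<omega>)) \<in> borel_measurable Q" for n
      using D'[of "Suc n"] by simp
  qed (use Om in auto)
  define C where "C = 2 * real N ^ 3 + 2 * real N * real k"
  have C: "0 \<le> C" by (simp add: C_def)
  have ZD: "cmod ((CLINT \<omega>|P. iexp (t * Z M \<omega>)) - (CLINT \<omega>|P. iexp (t * D L M \<omega>)))
      \<le> \<bar>t\<bar> * (C * \<eta>) + 2 * (1152 * real N / (real L * \<eta> ^ 4) + real M * real N * exp (- (\<eta> * sqrt (real M))))"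
    if \<eta>: "0 < \<eta>" and L: "1 \<le> L" and LM: "L \<le> M" and kM: "k \<le> M" for t \<eta> L M
  proof -
    obtain E1 where E1: "E1 \<in> P.events" "P.prob E1 \<le> 1152 * real N / (real L * \<eta> ^ 4)"
      "\<forall>\<omega>\<in>space P - E1. \<forall>j\<in>{1..N}. \<forall>l<L. \<forall>n\<in>{block_start M L l..block_start M L (Suc l)}.
        \<bar>\<Sum>i\<in>{block_start M L l<..n}. w i j \<omega> - 1\<bar> \<le> \<eta> * sqrt (real M)"
      by (rule P.oscillation_event[where N=N, OF L LM \<eta> indep w])
    have \<eta>M: "0 \<le> \<eta> * sqrt (real M)" using \<eta> by simp
    obtain E2 where E2: "E2 \<in> P.events" "P.prob E2 \<le> real M * real N * exp (- (\<eta> * sqrt (real M)))"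
      "\<forall>\<omega>\<in>space P - E2. \<forall>i\<in>{1..M}. \<forall>j\<in>{1..N}.
        0 \<le> w i j \<omega> \<and> w i j \<omega> \<le> \<eta> * sqrt (real M)"
      by (rule P.extreme_weight_event[where m=M and N=N, OF \<eta>M w])
    have "cmod ((CLINT \<omega>|P. iexp (t * Z M \<omega>)) - (CLINT \<omega>|P. iexp (t * D L M \<omega>)))
      \<le> \<bar>t\<bar> * (C * \<eta>) + 2 * P.prob (E1 \<union> E2)"
    proof (rule P.iexp_integral_diff_le[OF Z D[OF L]])
      show "E1 \<union> E2 \<in> P.events" by (intro sets.Un E1(1) E2(1))
      show "0 \<le> C * \<eta>" using C \<eta> by simp
      fix \<omega> assume \<omega>: "\<omega> \<in> space P" "\<omega> \<notin> E1 \<union> E2"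
      show "\<bar>Z M \<omega> - D L M \<omega>\<bar> \<le> C * \<eta>"
        unfolding Z_def D_def C_def
      proof (rule H_grid_approx[OF k kN kM L])
        show "0 \<le> \<eta>" using \<eta> by simp
        show "0 \<le> w i j \<omega> \<and> w i j \<omega> \<le> \<eta> * sqrt (real M)" if "i \<in> {1..M}" "j \<in> {1..N}" for i j
          using E2(3) \<omega> that by blast
        show "\<bar>\<Sum>i\<in>{block_start M L l<..n}. w i j \<omega> - 1\<bar> \<le> \<eta> * sqrt (real M)"
          if "j \<in> {1..N}" "l < L" "n \<in> {block_start M L l..block_start M L (Suc l)}" for j l n
          using E1(3) \<omega> that by blast
      qed
    qed
    moreover have "P.prob (E1 \<union> E2) \<le> 1152 * real N / (real L * \<eta> ^ 4) + real M * real N * exp (- (\<eta> * sqrt (real M)))"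
      by (rule order_trans[OF measure_Un_le[OF E1(1) E2(1)] add_mono[OF E1(2) E2(2)]])
    ultimately show ?thesis
      by (rule order_trans[OF _ add_left_mono[OF mult_left_mono]]) simp
  qed
  have "weak_conv_m (\<lambda>M. distr P borel (Z M)) (distr Q borel Om)"
  proof (rule levy_continuity)
    show "real_distribution (distr P borel (Z M))" for M by (rule P.real_distribution_distr[OF Z])
    show "real_distribution (distr Q borel Om)" by (rule Q.real_distribution_distr[OF Om])
    fix t
    have char_Z: "char (distr P borel (Z M)) t = (CLINT \<omega>|P. iexp (t * Z M \<omega>))" for M
      unfolding char_def using Z by (simp add: integral_distr)
    have char_O: "char (distr Q borel Om) t = (CLINT \<omega>|Q. iexp (t * Om \<omega>))"
      unfolding char_def using Om by (simp add: integral_distr)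
    show "(\<lambda>M. char (distr P borel (Z M)) t) \<longlonglongrightarrow> char (distr Q borel Om) t"
      unfolding char_Z char_O
    proof (rule tendstoI)
      fix \<epsilon> :: real assume \<epsilon>: "0 < \<epsilon>"
      \<comment> \<open>The error for parameter \<open>\<eta>\<close> splits into three parts, each made at most \<open>\<epsilon> / 8\<close>: the first by the
        choice of \<open>\<eta>\<close>, the second then by that of \<open>L\<close>, the third by letting \<open>M\<close> tend to infinity.\<close>
      define K where "K = \<bar>t\<bar> * C + 1"
      define \<eta> where "\<eta> = \<epsilon> / (8 * K)"
      have pos: "0 < K" using C by (simp add: K_def add_nonneg_pos)
      then have \<eta>: "0 < \<eta>" using \<epsilon> by (simp add: \<eta>_def)
      have t\<eta>: "\<bar>t\<bar> * (C * \<eta>) \<le> \<epsilon> / 8"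
      proof -
        have "\<bar>t\<bar> * (C * \<eta>) \<le> K * \<eta>" using \<eta> by (simp add: K_def algebra_simps)
        also have "\<dots> = \<epsilon> / 8" using pos by (simp add: \<eta>_def)
        finally show ?thesis .
      qed
      have "(\<lambda>L. 2304 * real N / \<eta> ^ 4 * (1 / real L)) \<longlonglongrightarrow> 2304 * real N / \<eta> ^ 4 * 0"
        by (intro tendsto_mult_left lim_1_over_n)
      then have ev1: "\<forall>\<^sub>F L in sequentially. 2304 * real N / \<eta> ^ 4 * (1 / real L) < \<epsilon> / 8"
        using \<epsilon> by (intro order_tendstoD) auto
      have ev2: "\<forall>\<^sub>F L in sequentially. dist (CLINT \<omega>|Q. iexp (t * D' L \<omega>)) (CLINT \<omega>|Q. iexp (t * Om \<omega>)) < \<epsilon> / 4"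
        using \<epsilon> by (intro tendstoD[OF char_D'Om]) simp
      obtain L where L: "1 \<le> L" "2304 * real N / \<eta> ^ 4 * (1 / real L) < \<epsilon> / 8"
        "dist (CLINT \<omega>|Q. iexp (t * D' L \<omega>)) (CLINT \<omega>|Q. iexp (t * Om \<omega>)) < \<epsilon> / 4"
        using eventually_happens'[OF sequentially_bot eventually_conj[OF eventually_ge_at_top[of 1] eventually_conj[OF ev1 ev2]]]
        by blast
      have "(\<lambda>M. 2 * real N * (real M * exp (- (\<eta> * sqrt (real M))))) \<longlonglongrightarrow> 2 * real N * 0"
        by (intro tendsto_mult_left tendsto_mult_exp_sqrt \<eta>)
      then have ev3: "\<forall>\<^sub>F M in sequentially. 2 * real N * (real M * exp (- (\<eta> * sqrt (real M)))) < \<epsilon> / 8"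
        using \<epsilon> by (intro order_tendstoD) auto
      have ev4: "\<forall>\<^sub>F M in sequentially. dist (CLINT \<omega>|P. iexp (t * D L M \<omega>)) (CLINT \<omega>|Q. iexp (t * D' L \<omega>)) < \<epsilon> / 4"
        using \<epsilon> by (intro tendstoD[OF DD'[OF L(1)]]) simp
      show "\<forall>\<^sub>F M in sequentially. dist (CLINT \<omega>|P. iexp (t * Z M \<omega>)) (CLINT \<omega>|Q. iexp (t * Om \<omega>)) < \<epsilon>"
        using eventually_ge_at_top[of L] eventually_ge_at_top[of k] ev3 ev4
      proof eventually_elim
        case (elim M)
        have "dist (CLINT \<omega>|P. iexp (t * Z M \<omega>)) (CLINT \<omega>|P. iexp (t * D L M \<omega>))
          \<le> \<bar>t\<bar> * (C * \<eta>) + 2 * (1152 * real N / (real L * \<eta> ^ 4) + real M * real N * exp (- (\<eta> * sqrt (real M))))"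
          unfolding dist_norm by (rule ZD[OF \<eta> L(1) elim(1,2)])
        moreover have "2 * (1152 * real N / (real L * \<eta> ^ 4) + real M * real N * exp (- (\<eta> * sqrt (real M))))
          = 2304 * real N / \<eta> ^ 4 * (1 / real L) + 2 * real N * (real M * exp (- (\<eta> * sqrt (real M))))"
          by (simp add: algebra_simps)
        moreover have "a < \<epsilon> / 2" if "a \<le> x + y" "y = u + v" "x \<le> \<epsilon> / 8" "u < \<epsilon> / 8" "v < \<epsilon> / 8"
          for a x y u v :: real
          using that \<epsilon> by linarith
        ultimately have "dist (CLINT \<omega>|P. iexp (t * Z M \<omega>)) (CLINT \<omega>|P. iexp (t * D L M \<omega>)) < \<epsilon> / 2"
          using t\<eta> L(2) elim(3) by blast
        then show ?case
          using dist_triangle[of "CLINT \<omega>|P. iexp (t * Z M \<omega>)" "CLINT \<omega>|Q. iexp (t * Om \<omega>)" "CLINT \<omega>|P. iexp (t * D L M \<omega>)"]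
            dist_triangle[of "CLINT \<omega>|P. iexp (t * D L M \<omega>)" "CLINT \<omega>|Q. iexp (t * Om \<omega>)" "CLINT \<omega>|Q. iexp (t * D' L \<omega>)"]
            elim(4) L(3) by linarith
      qed
    qed
  qed
  then show ?thesis unfolding Z_def[abs_def] Om_def[abs_def] .
qed

end
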